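(* Fix $q\in\mathbb{C}$ with $|q|>1$. Let $N\geq 1$ and $\alpha\in\mathbb{N}^+$. Let $F(x,\epsilon,y)$ be a $\mathbb{C}^N$-valued function, analytic in a neighborhood of $(0,0,0)\in\mathbb{C}\times\mathbb{C}\times\mathbb{C}^N$, such that $F(0,0,0)=0$ and the Jacobian matrix $D_yF(0,0,0)\in\mathbb{C}^{N\times N}$ of $F$ with respect to $y$ is invertible. Consider the system $$\epsilon^\alpha d_{q,x}(y)(x,\epsilon)=F(x,\epsilon,y),$$ with unknown $y\in\mathbb{C}^N$. Then the system has a unique formal power series solution $\hat{y}=\sum_{n=0}^\infty u_n(x)\epsilon^n\in\mathbb{C}[[x,\epsilon]]^N$ (with $\hat y(0,0)=0$), and there is $r>0$ such that, for all $n\ge 0$, the entries of $u_n$ belong to $\mathcal{O}_b(D_{r/|q|^{\lfloor n/\alpha\rfloor}})$. Moreover, there are constants $C=C(q)>0$, $A=A(q)>0$ such that, for all $n\geq 0$, $$\sup_{|x|< r/|q|^{\lfloor n/\alpha\rfloor}}|u_n(x)|\leq CA^n|q|^{\frac{n^2}{2\alpha^2}}.$$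
   Context: $\mathbb{N}^+$ denotes the positive integers. For $R>0$, $D_R=\{x\in\mathbb{C}:|x|<R\}$, and $\mathcal{O}_b(D_R)$ is the space of bounded holomorphic functions $D_R\to\mathbb{C}$. A formal power series in one variable is said to belong to $\mathcal{O}_b(D_R)$ if it converges on $D_R$ to a bounded holomorphic function. For vectors in $\mathbb{C}^N$, $|\cdot|$ is the maximum norm. For a function or formal power series $y(x,\epsilon)$, $d_{q,x}(y)(x,\epsilon)=\dfrac{y(qx,\epsilon)-y(x,\epsilon)}{qx-x}$. On formal power series it acts term by term, by $d_{q,x}(x^n)=[n]_qx^{n-1}$ with $[n]_q=\frac{q^n-1}{q-1}$ (so $d_{q,x}(1)=0$), and it acts componentwise on vectors. A formal solution is a series $\hat y\in\mathbb{C}[[x,\epsilon]]^N$ with zero constant term (so that the composition $F(x,\epsilon,\hat y)$ with the Taylor expansion of $F$ at the origin is a well-defined formal power series) satisfying the system identically in $\mathbb{C}[[x,\epsilon]]^N$. *)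

theory Defs
  imports "HOL-Analysis.Analysis" "HOL-Library.Groups_Big_Fun"
begin

text \<open>
  Analytic maps \<open>\<complex> \<times> \<complex> \<times> \<complex>\<^sup>N \<rightarrow> \<complex>\<^sup>N\<close>. The index \<open>(i, j, m)\<close> stands for the monomial
  \<open>x\<^sup>i \<epsilon>\<^sup>j y\<^sup>m\<close>, where \<open>m\<close> is a multi-index. On a finite-dimensional space unconditional summation
  (\<open>has_sum\<close>) is absolute convergence.
\<close>

definition has_power_series_at ::
  "(complex \<times> complex \<times> (complex ^ 'n) \<Rightarrow> complex ^ 'n) \<Rightarrow> complex \<times> complex \<times> (complex ^ 'n)
    \<Rightarrow> (nat \<times> nat \<times> ('n::finite \<Rightarrow> nat) \<Rightarrow> complex ^ 'n) \<Rightarrow> bool" where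
  "has_power_series_at F p c \<longleftrightarrow>
    (case p of (x0, e0, y0) \<Rightarrow>
      \<forall>\<^sub>F (x, e, y) in nhds p.
        ((\<lambda>(i, j, m). ((x - x0) ^ i * (e - e0) ^ j * (\<Prod>k\<in>UNIV. (y $ k - y0 $ k) ^ m k)) *s c (i, j, m))
          has_sum F (x, e, y)) UNIV)"

definition analytic_near ::
  "(complex \<times> complex \<times> (complex ^ 'n) \<Rightarrow> complex ^ 'n) \<Rightarrow> complex \<times> complex \<times> (complex ^ 'n) \<Rightarrow> bool" where
  "analytic_near F p \<longleftrightarrow>
    (\<exists>U. open U \<and> p \<in> U \<and> (\<forall>z\<in>U. \<exists>c. has_power_series_at F z c))"

text \<open>
  The Taylor coefficients at the origin. The choice is harmless: the coefficients of a power series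
  that converges to \<open>F\<close> on a neighbourhood of the origin are determined by \<open>F\<close>.
\<close>

definition taylor_coeff ::
  "(complex \<times> complex \<times> (complex ^ 'n) \<Rightarrow> complex ^ 'n)
    \<Rightarrow> nat \<times> nat \<times> ('n::finite \<Rightarrow> nat) \<Rightarrow> complex ^ 'n" where
  "taylor_coeff F = (SOME c. has_power_series_at F (0, 0, 0) c)"

definition jacobian_y0 ::
  "(complex \<times> complex \<times> (complex ^ 'n) \<Rightarrow> complex ^ 'n) \<Rightarrow> complex ^ 'n ^ 'n" where
  "jacobian_y0 F = (\<chi> k l. deriv (\<lambda>t. F (0, 0, axis l t) $ k) 0)"

definition qnum :: "complex \<Rightarrow> nat \<Rightarrow> complex" where
  "qnum q n = (q ^ n - 1) / (q - 1)"

text \<open>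
  \<open>\<complex>[[x, \<epsilon>]]\<close> is rendered as \<open>\<complex>[[x]][[\<epsilon>]]\<close>, the type \<open>complex fps fps\<close>: the outer variable is
  \<open>\<epsilon>\<close> (the series \<open>fps_X\<close>), the inner one is \<open>x\<close> (the series \<open>fps_const fps_X\<close>). Thus
  \<open>fps_nth (y $ k) n\<close> is the \<open>k\<close>-th entry of the coefficient \<open>u\<^sub>n(x)\<close> of \<open>\<epsilon>\<^sup>n\<close>.
\<close>

definition qderiv :: "complex \<Rightarrow> complex fps \<Rightarrow> complex fps" where
  "qderiv q f = Abs_fps (\<lambda>n. qnum q (Suc n) * fps_nth f (Suc n))"

lemma qderiv_fps_X_power:
  "qderiv q (fps_X ^ n) = fps_const (qnum q n) * fps_X ^ (n - 1)"
  by (cases n) (auto simp: qderiv_def qnum_def fps_eq_iff fps_X_power_iff)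

definition qderiv_x :: "complex \<Rightarrow> complex fps fps \<Rightarrow> complex fps fps" where
  "qderiv_x q f = Abs_fps (\<lambda>n. qderiv q (fps_nth f n))"

definition zero_const_term :: "complex fps fps ^ 'n \<Rightarrow> bool" where
  "zero_const_term y \<longleftrightarrow> (\<forall>k. fps_nth (fps_nth (y $ k) 0) 0 = 0)"

text \<open>
  The composition \<open>F(x, \<epsilon>, y)\<close> of a series \<open>\<Sum> c\<^sub>i\<^sub>j\<^sub>m x\<^sup>i \<epsilon>\<^sup>j y\<^sup>m\<close> with a formal \<open>y\<close>. If \<open>y\<close> has zero
  constant term, then only finitely many \<open>(i, j, m)\<close> contribute to each coefficient \<open>x\<^sup>a \<epsilon>\<^sup>b\<close>
  (those with \<open>i + j + |m| \<le> a + b\<close>), so that \<open>Sum_any\<close> is a genuine finite sum.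
\<close>

definition formal_monomial ::
  "complex fps fps ^ 'n \<Rightarrow> nat \<times> nat \<times> ('n::finite \<Rightarrow> nat) \<Rightarrow> complex fps fps" where
  "formal_monomial y = (\<lambda>(i, j, m). fps_const fps_X ^ i * fps_X ^ j * (\<Prod>k\<in>UNIV. (y $ k) ^ m k))"

definition formal_compose ::
  "(nat \<times> nat \<times> ('n::finite \<Rightarrow> nat) \<Rightarrow> complex ^ 'n) \<Rightarrow> complex fps fps ^ 'n \<Rightarrow> complex fps fps ^ 'n" where
  "formal_compose c y =
    (\<chi> k. Abs_fps (\<lambda>b. Abs_fps (\<lambda>a.
      Sum_any (\<lambda>d. c d $ k * fps_nth (fps_nth (formal_monomial y d) b) a))))"

definition formal_solution ::
  "complex \<Rightarrow> nat \<Rightarrow> (complex \<times> complex \<times> (complex ^ 'n) \<Rightarrow> complex ^ 'n)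
    \<Rightarrow> complex fps fps ^ 'n \<Rightarrow> bool" where
  "formal_solution q \<alpha> F y \<longleftrightarrow>
    zero_const_term y \<and>
    (\<chi> k. fps_X ^ \<alpha> * qderiv_x q (y $ k)) = formal_compose (taylor_coeff F) y"

definition in_Ob :: "real \<Rightarrow> complex fps \<Rightarrow> bool" where
  "in_Ob R f \<longleftrightarrow>
    (\<forall>x\<in>ball 0 R. summable (\<lambda>k. fps_nth f k * x ^ k)) \<and>
    eval_fps f holomorphic_on ball 0 R \<and> bounded (eval_fps f ` ball 0 R)"

definition max_norm :: "complex ^ 'n \<Rightarrow> real" where
  "max_norm v = Max (range (\<lambda>k. cmod (v $ k)))"

definition eps_coeff_at :: "complex fps fps ^ 'n \<Rightarrow> nat \<Rightarrow> complex \<Rightarrow> complex ^ 'n" where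
  "eps_coeff_at y n x = (\<chi> k. eval_fps (fps_nth (y $ k) n) x)"

end

theory Submission
  imports Defs
begin

text \<open>
  Give the monomial \<open>x\<^sup>k \<epsilon>\<^sup>n\<close> the weight \<open>2n + k\<close>. Write \<open>F = A y + H\<close>, where \<open>A\<close> is the Jacobian at
  the origin, so that \<open>H\<close> has neither a constant term nor a pure linear term in \<open>y\<close>. The system is
  then the fixed point equation \<open>y = B (\<epsilon>\<^sup>\<alpha> d\<^sub>q y - H(x, \<epsilon>, y))\<close> with \<open>B\<close> the inverse of \<open>A\<close>. The
  \<open>q\<close>-derivative lowers the power of \<open>x\<close> by one, but \<open>\<epsilon>\<^sup>\<alpha>\<close> has weight at least two, and a monomial of
  \<open>H\<close> that contains \<open>y\<close> multiplies a factor \<open>y\<close> by something of positive weight. Hence the right-hand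
  side gains one order in the weight filtration (\<open>solution_operator_contracts\<close>): there is exactly
  one formal solution, and it is the limit of the iterates that start from \<open>0\<close>.

  For the estimates, every coefficient is divided by the growth that it is expected to have. With
  \<open>Q = |q|\<close> and \<open>t = \<lfloor>n / \<alpha>\<rfloor>\<close>, the function \<open>g(n, k) = Q\<^bsup>t(t-1)/2 + kt\<^esup>\<close> satisfies
  \<open>g(n, k) = Q\<^sup>k g(n - \<alpha>, k + 1)\<close>, and \<open>Q\<^sup>k\<close> is the size of the factor \<open>[k + 1]\<^sub>q\<close> of the
  \<open>q\<close>-derivative up to a constant; moreover \<open>g\<close> is supermultiplicative. Therefore the norm
  \<open>\<Sum> |f\<^sub>n\<^sub>k| \<eta>\<^bsup>2n + k\<^esup> / g(n, k)\<close>, truncated at any weight, is submultiplicative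
  (\<open>truncated_norm_mult\<close>), and \<open>\<epsilon>\<^sup>\<alpha> d\<^sub>q\<close> is bounded by a constant times \<open>\<eta>\<close> for it
  (\<open>truncated_norm_eps_power_qderiv\<close>). Since \<open>H\<close> is quadratically small in \<open>y\<close> up to terms with a
  factor \<open>x\<close> or \<open>\<epsilon>\<close>, the ball of a small radius \<open>\<delta>\<close> is mapped to itself once \<open>\<eta>\<close> is small
  (\<open>truncated_norm_iterate\<close>). So all iterates have norm at most \<open>\<delta>\<close> at every truncation level, which
  bounds the coefficients of the solution by
  \<open>|y\<^sub>n\<^sub>k| \<le> \<delta> \<eta>\<^bsup>-2n\<^esup> Q\<^bsup>t(t-1)/2\<^esup> (Q\<^sup>t / \<eta>)\<^sup>k\<close>. Summing a geometric series on the disc of radius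
  \<open>(\<eta> / 2) / Q\<^sup>t\<close> and using \<open>t(t-1)/2 \<le> n\<^sup>2 / (2\<alpha>\<^sup>2)\<close> gives the theorem.
\<close>

section \<open>The weight filtration on formal series in two variables\<close>

abbreviation coeff2 :: "complex fps fps \<Rightarrow> nat \<Rightarrow> nat \<Rightarrow> complex" where
  "coeff2 f n k \<equiv> fps_nth (fps_nth f n) k"

lemma coeff2_eqI: "(\<And>n k. coeff2 f n k = coeff2 g n k) \<Longrightarrow> f = g"
  by (simp add: fps_eq_iff)

lemma coeff2_mult:
  "coeff2 (f * g) n k = (\<Sum>i\<le>n. \<Sum>j\<le>k. coeff2 f i j * coeff2 g (n - i) (k - j))"
  by (simp add: fps_mult_nth fps_sum_nth atLeast0AtMost)

lemma coeff2_eps_power_qderiv: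
  "coeff2 (fps_X ^ \<alpha> * qderiv_x q f) n k =
    (if n < \<alpha> then 0 else qnum q (Suc k) * coeff2 f (n - \<alpha>) (Suc k))"
  by (simp add: fps_X_power_mult_nth qderiv_x_def qderiv_def)

text \<open>
  The ideal of the series of order at least \<open>w\<close>. The variable \<open>\<epsilon>\<close> counts twice, so that \<open>\<epsilon>\<^sup>\<alpha>\<close>
  outweighs the power of \<open>x\<close> lost by the \<open>q\<close>-derivative.
\<close>
definition vanishes_below :: "nat \<Rightarrow> complex fps fps \<Rightarrow> bool" where
  "vanishes_below w f \<longleftrightarrow> (\<forall>n k. 2 * n + k < w \<longrightarrow> coeff2 f n k = 0)"

lemma vanishes_below_zero [simp]: "vanishes_below w 0"
  by (simp add: vanishes_below_def)

lemma vanishes_below_add: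
  "vanishes_below w f \<Longrightarrow> vanishes_below w g \<Longrightarrow> vanishes_below w (f + g)"
  by (simp add: vanishes_below_def)

lemma vanishes_below_diff:
  "vanishes_below w f \<Longrightarrow> vanishes_below w g \<Longrightarrow> vanishes_below w (f - g)"
  by (simp add: vanishes_below_def)

lemma vanishes_below_mono: "vanishes_below w f \<Longrightarrow> v \<le> w \<Longrightarrow> vanishes_below v f"
  by (simp add: vanishes_below_def)

lemma vanishes_below_mult:
  assumes "vanishes_below v f" "vanishes_below w g"
  shows "vanishes_below (v + w) (f * g)"
  unfolding vanishes_below_def coeff2_mult
proof (intro allI impI sum.neutral ballI)
  fix n k i j assume "2 * n + k < v + w" "i \<in> {..n}" "j \<in> {..k}"
  then have "2 * i + j < v \<or> 2 * (n - i) + (k - j) < w" by auto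
  then show "coeff2 f i j * coeff2 g (n - i) (k - j) = 0"
    using assms by (auto simp: vanishes_below_def)
qed

lemma vanishes_below_all_imp_zero:
  assumes "\<And>w. vanishes_below w f" shows "f = 0"
proof (rule coeff2_eqI)
  fix n k
  show "coeff2 f n k = coeff2 0 n k"
    using assms[of "Suc (2 * n + k)"] by (simp add: vanishes_below_def)
qed

lemma vanishes_below_1_iff: "vanishes_below (Suc 0) f \<longleftrightarrow> coeff2 f 0 0 = 0"
  by (auto simp: vanishes_below_def)

lemma zero_const_term_iff: "zero_const_term y \<longleftrightarrow> (\<forall>k. vanishes_below 1 (y $ k))"
  by (simp add: zero_const_term_def vanishes_below_1_iff)

lemma vanishes_below_eps_power_qderiv:
  assumes "vanishes_below w f" "\<alpha> \<ge> 1"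
  shows "vanishes_below (w + 1) (fps_X ^ \<alpha> * qderiv_x q f)"
  using assms unfolding vanishes_below_def coeff2_eps_power_qderiv by auto

text \<open>
  Two series of order \<open>a\<close> whose difference is smaller by \<open>v\<close> further orders. The gain \<open>v\<close> over the
  own order is kept by products, while the orders \<open>a\<close> add up; this is the reason for tracking both.
\<close>
definition close_of_order :: "nat \<Rightarrow> nat \<Rightarrow> complex fps fps \<Rightarrow> complex fps fps \<Rightarrow> bool" where
  "close_of_order v a f g \<longleftrightarrow>
    vanishes_below a f \<and> vanishes_below a g \<and> vanishes_below (v + a) (f - g)"

lemma close_of_order_mult:
  assumes "close_of_order v a f f'" "close_of_order v b g g'"
  shows "close_of_order v (a + b) (f * g) (f' * g')"
proof -
  have "vanishes_below (a + (v + b)) (f * (g - g'))" "vanishes_below (v + a + b) ((f - f') * g')"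
    using assms by (auto simp: close_of_order_def intro!: vanishes_below_mult)
  then have "vanishes_below (v + (a + b)) (f * (g - g') + (f - f') * g')"
    by (intro vanishes_below_add) (simp_all add: ac_simps)
  also have "f * (g - g') + (f - f') * g' = f * g - f' * g'" by (simp add: algebra_simps)
  finally show ?thesis
    using assms by (auto simp: close_of_order_def intro!: vanishes_below_mult)
qed

lemma close_of_order_one: "close_of_order v 0 1 1"
  by (simp add: close_of_order_def vanishes_below_def)

lemma close_of_order_power:
  "close_of_order v a f g \<Longrightarrow> close_of_order v (n * a) (f ^ n) (g ^ n)"
  by (induction n) (auto intro: close_of_order_mult simp: close_of_order_one)

lemma close_of_order_prod:
  assumes "finite I" "\<And>i. i \<in> I \<Longrightarrow> close_of_order v (a i) (f i) (g i)"
  shows "close_of_order v (\<Sum>i\<in>I. a i) (\<Prod>i\<in>I. f i) (\<Prod>i\<in>I. g i)"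
  using assms by (induction I) (auto intro: close_of_order_mult simp: close_of_order_one)

lemma close_of_order_x: "close_of_order v 1 (fps_const fps_X) (fps_const fps_X)"
  by (simp add: close_of_order_def vanishes_below_1_iff)

lemma close_of_order_eps: "close_of_order v 2 fps_X fps_X"
  by (auto simp: close_of_order_def vanishes_below_def)

section \<open>Substituting a formal vector into a power series\<close>

text \<open>
  A component of \<open>y\<close> counts as one because its constant term vanishes. So this is a lower bound for
  the order of the monomial after substitution.
\<close>
definition monomial_weight :: "nat \<times> nat \<times> ('n::finite \<Rightarrow> nat) \<Rightarrow> nat" where
  "monomial_weight = (\<lambda>(i, j, m). i + 2 * j + (\<Sum>k\<in>UNIV. m k))"

lemma finite_monomial_weight_le:
  "finite {d :: nat \<times> nat \<times> ('n::finite \<Rightarrow> nat). monomial_weight d \<le> w}"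
proof (rule finite_subset)
  show "{d :: nat \<times> nat \<times> ('n \<Rightarrow> nat). monomial_weight d \<le> w} \<subseteq> {..w} \<times> {..w} \<times> (PiE UNIV (\<lambda>_. {..w}))"
  proof
    fix d :: "nat \<times> nat \<times> ('n \<Rightarrow> nat)" assume "d \<in> {d. monomial_weight d \<le> w}"
    then obtain i j m where d: "d = (i, j, m)" and le: "i + 2 * j + (\<Sum>k\<in>UNIV. m k) \<le> w"
      by (cases d) (auto simp: monomial_weight_def)
    have "m k \<le> w" for k using le member_le_sum[of k UNIV m] by simp
    then show "d \<in> {..w} \<times> {..w} \<times> (PiE UNIV (\<lambda>_. {..w}))"
      using le by (auto simp: d)
  qed
qed (intro finite_cartesian_product finite_PiE; simp)

lemma formal_monomial_close:
  assumes "\<And>k. vanishes_below 1 (y $ k)" "\<And>k. vanishes_below 1 (z $ k)"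
    and "\<And>k. vanishes_below (v + 1) (y $ k - z $ k)"
  shows "close_of_order v (monomial_weight d) (formal_monomial y d) (formal_monomial z d)"
proof -
  obtain i j m where d: "d = (i, j, m)" by (cases d)
  have "close_of_order v (m k * 1) (y $ k ^ m k) (z $ k ^ m k)" for k
    using assms by (intro close_of_order_power) (simp add: close_of_order_def)
  then have "close_of_order v (\<Sum>k\<in>UNIV. m k) (\<Prod>k\<in>UNIV. y $ k ^ m k) (\<Prod>k\<in>UNIV. z $ k ^ m k)"
    by (intro close_of_order_prod) auto
  with close_of_order_power[OF close_of_order_x, of v i]
    close_of_order_power[OF close_of_order_eps, of v j]
  have "close_of_order v (i * 1 + j * 2 + (\<Sum>k\<in>UNIV. m k))
      (fps_const fps_X ^ i * fps_X ^ j * (\<Prod>k\<in>UNIV. y $ k ^ m k))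
      (fps_const fps_X ^ i * fps_X ^ j * (\<Prod>k\<in>UNIV. z $ k ^ m k))"
    by (intro close_of_order_mult)
  then show ?thesis
    by (simp add: d monomial_weight_def formal_monomial_def mult.commute)
qed

lemma vanishes_below_formal_monomial:
  assumes "zero_const_term y"
  shows "vanishes_below (monomial_weight d) (formal_monomial y d)"
  using formal_monomial_close[of y y 0 d] assms
  by (auto simp: close_of_order_def zero_const_term_iff)

lemma coeff2_formal_compose:
  assumes "zero_const_term y" "2 * n + k \<le> w"
  shows "coeff2 (formal_compose c y $ l) n k =
    (\<Sum>d | monomial_weight d \<le> w. c d $ l * coeff2 (formal_monomial y d) n k)"
proof -
  have "coeff2 (formal_compose c y $ l) n k
      = Sum_any (\<lambda>d. c d $ l * coeff2 (formal_monomial y d) n k)"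
    by (simp add: formal_compose_def)
  also have "\<dots> = (\<Sum>d | monomial_weight d \<le> w. c d $ l * coeff2 (formal_monomial y d) n k)"
  proof (rule Sum_any.expand_superset[OF finite_monomial_weight_le], safe)
    fix i j m assume *: "c (i, j, m) $ l * coeff2 (formal_monomial y (i, j, m)) n k \<noteq> 0"
    show "monomial_weight (i, j, m) \<le> w"
    proof (rule ccontr)
      assume "\<not> ?thesis"
      then have "coeff2 (formal_monomial y (i, j, m)) n k = 0"
        using vanishes_below_formal_monomial[OF assms(1), of "(i, j, m)"] assms(2)
        by (simp add: vanishes_below_def)
      with * show False by simp
    qed
  qed
  finally show ?thesis .
qed

section \<open>Splitting off the linear part\<close>

text \<open>The index of the monomial \<open>y\<^sub>l\<close>.\<close>
definition linear_index :: "'n::finite \<Rightarrow> nat \<times> nat \<times> ('n \<Rightarrow> nat)" where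
  "linear_index l = (0, 0, \<lambda>k. of_bool (k = l))"

lemma inj_linear_index: "inj linear_index"
  by (auto simp: inj_def linear_index_def fun_eq_iff)

lemma monomial_weight_linear_index [simp]: "monomial_weight (linear_index l) = 1"
  by (simp add: monomial_weight_def linear_index_def of_bool_def)

lemma formal_monomial_linear_index: "formal_monomial y (linear_index l) = y $ l"
proof -
  have "(\<Prod>k\<in>UNIV. y $ k ^ of_bool (k = l)) = (\<Prod>k\<in>UNIV. if k = l then y $ k else 1)"
    by (intro prod.cong) auto
  then show ?thesis by (simp add: formal_monomial_def linear_index_def)
qed

text \<open>
  A monomial of weight at most one is \<open>1\<close>, \<open>x\<close> or some \<open>y\<^sub>l\<close>. Once the linear ones are removed, a
  monomial that depends on \<open>y\<close> has weight at least two.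
\<close>
lemma weight_one_cases:
  assumes "monomial_weight (i, j, m) \<le> 1" "(i, j, m) \<notin> range linear_index"
  shows "m = (\<lambda>_. 0)"
proof (rule ccontr)
  assume "m \<noteq> (\<lambda>_. 0)"
  then obtain l where l: "m l \<noteq> 0" by auto
  have sum: "(\<Sum>k\<in>UNIV. m k) = m l + (\<Sum>k\<in>UNIV - {l}. m k)"
    by (rule sum.remove) auto
  have "i + 2 * j + (\<Sum>k\<in>UNIV. m k) \<le> 1" using assms(1) by (simp add: monomial_weight_def)
  with l have ij: "i = 0" "j = 0" "m l = 1" "(\<Sum>k\<in>UNIV - {l}. m k) = 0"
    unfolding sum by linarith+
  then have "m k = of_bool (k = l)" for k by (cases "k = l") auto
  then have "m = (\<lambda>k. of_bool (k = l))" by blast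
  with ij assms(2) show False by (auto simp: linear_index_def)
qed

definition nonlinear_part where
  "nonlinear_part c d = (if d \<in> range linear_index then 0 else c d)"

definition linear_part :: "(nat \<times> nat \<times> ('n::finite \<Rightarrow> nat) \<Rightarrow> complex ^ 'n) \<Rightarrow> complex ^ 'n ^ 'n" where
  "linear_part c = (\<chi> k l. c (linear_index l) $ k)"

definition const_matrix :: "complex ^ 'n ^ 'n \<Rightarrow> complex fps fps ^ 'n ^ 'n" where
  "const_matrix A = (\<chi> k l. fps_const (fps_const (A $ k $ l)))"

lemma coeff2_const_matrix_mult:
  "coeff2 ((const_matrix A *v y) $ k) n j = (\<Sum>l\<in>UNIV. A $ k $ l * coeff2 (y $ l) n j)"
  by (simp add: matrix_vector_mult_def const_matrix_def fps_sum_nth)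

lemma const_matrix_mult_inverse:
  assumes "A ** B = mat 1"
  shows "const_matrix A *v (const_matrix B *v y) = y"
proof -
  have "const_matrix A ** const_matrix B = const_matrix (A ** B)"
    by (simp add: matrix_matrix_mult_def const_matrix_def vec_eq_iff fps_eq_iff fps_sum_nth
        flip: fps_const_mult)
  also have "\<dots> = mat 1" by (simp add: assms const_matrix_def mat_def vec_eq_iff)
  finally show ?thesis by (simp add: matrix_vector_mul_assoc)
qed

lemma formal_compose_split:
  assumes "zero_const_term y"
  shows "formal_compose c y = const_matrix (linear_part c) *v y + formal_compose (nonlinear_part c) y"
proof -
  have "coeff2 (formal_compose c y $ l) n k =
      coeff2 ((const_matrix (linear_part c) *v y + formal_compose (nonlinear_part c) y) $ l) n k" for l n k
  proof -
    define w where "w = 2 * n + k + 1"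
    let ?g = "\<lambda>c d. c d $ l * coeff2 (formal_monomial y d) n k"
    let ?D = "{d :: nat \<times> nat \<times> ('a \<Rightarrow> nat). monomial_weight d \<le> w}"
    have sub: "range linear_index \<subseteq> ?D" by (auto simp: w_def)
    have "coeff2 (formal_compose c y $ l) n k = (\<Sum>d\<in>?D. ?g c d)"
      by (rule coeff2_formal_compose[OF assms]) (simp add: w_def)
    also have "\<dots> = (\<Sum>d\<in>range linear_index. ?g c d) + (\<Sum>d\<in>?D - range linear_index. ?g c d)"
      by (subst sum.subset_diff[OF sub finite_monomial_weight_le]) (rule add.commute)
    also have "(\<Sum>d\<in>range linear_index. ?g c d) = coeff2 ((const_matrix (linear_part c) *v y) $ l) n k"
      by (simp add: sum.reindex[OF inj_linear_index] formal_monomial_linear_index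
          coeff2_const_matrix_mult linear_part_def)
    also have "(\<Sum>d\<in>?D - range linear_index. ?g c d) = (\<Sum>d\<in>?D. ?g (nonlinear_part c) d)"
      by (rule sum.mono_neutral_cong_left)
        (auto simp: nonlinear_part_def finite_monomial_weight_le)
    also have "\<dots> = coeff2 (formal_compose (nonlinear_part c) y $ l) n k"
      by (rule coeff2_formal_compose[OF assms, symmetric]) (simp add: w_def)
    finally show ?thesis by simp
  qed
  then show ?thesis by (simp add: vec_eq_iff coeff2_eqI)
qed

text \<open>
  A monomial of weight at least two passes on one order more than the difference \<open>y - z\<close> has, by
  \<open>formal_monomial_close\<close>; the remaining nonlinear monomials are \<open>1\<close> and \<open>x\<close>, on which \<open>y\<close> and \<open>z\<close>
  give the same value.
\<close>
lemma formal_compose_nonlinear_close: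
  assumes "zero_const_term y" "zero_const_term z"
    and "\<And>k. vanishes_below (v + 1) (y $ k - z $ k)"
  shows "vanishes_below (v + 2)
    (formal_compose (nonlinear_part c) y $ l - formal_compose (nonlinear_part c) z $ l)"
proof -
  have mon: "vanishes_below (v + 2) (formal_monomial y d - formal_monomial z d)"
    if "d \<notin> range linear_index" for d
  proof (cases "monomial_weight d \<ge> 2")
    case True
    have "vanishes_below (v + monomial_weight d) (formal_monomial y d - formal_monomial z d)"
      using formal_monomial_close[of y z v d] assms
      by (simp add: zero_const_term_iff close_of_order_def)
    then show ?thesis by (rule vanishes_below_mono) (use True in simp)
  next
    case False
    obtain i j m where d: "d = (i, j, m)" by (cases d)
    then have "m = (\<lambda>_. 0)" using weight_one_cases[of i j m] False that by simp
    then show ?thesis by (simp add: d formal_monomial_def)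
  qed
  show ?thesis
    unfolding vanishes_below_def
  proof (intro allI impI)
    fix n k assume nk: "2 * n + k < v + 2"
    have "nonlinear_part c d $ l * coeff2 (formal_monomial y d) n k =
        nonlinear_part c d $ l * coeff2 (formal_monomial z d) n k" for d
      using mon[of d] nk by (auto simp: nonlinear_part_def vanishes_below_def)
    note sums = sum.cong[OF refl this]
    then show "coeff2 (formal_compose (nonlinear_part c) y $ l
        - formal_compose (nonlinear_part c) z $ l) n k = 0"
      using coeff2_formal_compose[OF assms(1) le_refl, of "nonlinear_part c" l n k]
        coeff2_formal_compose[OF assms(2) le_refl, of "nonlinear_part c" l n k] sums
      by (simp only: fps_sub_nth right_minus_eq)
  qed
qed

section \<open>Existence and uniqueness of the formal solution\<close>

text \<open>Here \<open>B\<close> is meant to be the inverse of \<open>linear_part c\<close>.\<close>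
definition solution_operator where
  "solution_operator q \<alpha> c B y =
    const_matrix B *v ((\<chi> k. fps_X ^ \<alpha> * qderiv_x q (y $ k)) - formal_compose (nonlinear_part c) y)"

lemma solution_iff_fixed_point:
  assumes "zero_const_term y" "linear_part c ** B = mat 1" "B ** linear_part c = mat 1"
  shows "(\<chi> k. fps_X ^ \<alpha> * qderiv_x q (y $ k)) = formal_compose c y \<longleftrightarrow>
    y = solution_operator q \<alpha> c B y" (is "?D = _ \<longleftrightarrow> _")
proof -
  have "?D = formal_compose c y \<longleftrightarrow>
      ?D - formal_compose (nonlinear_part c) y = const_matrix (linear_part c) *v y"
    unfolding formal_compose_split[OF assms(1), of c] by (simp add: diff_eq_eq)
  also have "\<dots> \<longleftrightarrow> y = solution_operator q \<alpha> c B y"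
  proof
    assume "?D - formal_compose (nonlinear_part c) y = const_matrix (linear_part c) *v y"
    then show "y = solution_operator q \<alpha> c B y"
      by (simp add: solution_operator_def const_matrix_mult_inverse[OF assms(3)])
  next
    assume "y = solution_operator q \<alpha> c B y"
    then have "const_matrix (linear_part c) *v y =
        const_matrix (linear_part c) *v solution_operator q \<alpha> c B y" by simp
    then show "?D - formal_compose (nonlinear_part c) y = const_matrix (linear_part c) *v y"
      by (simp add: solution_operator_def const_matrix_mult_inverse[OF assms(2)])
  qed
  finally show ?thesis .
qed

lemma vanishes_below_const_matrix_mult:
  assumes "\<And>k. vanishes_below w (y $ k)"
  shows "vanishes_below w ((const_matrix A *v y) $ l)"
  using assms by (simp add: vanishes_below_def coeff2_const_matrix_mult)

lemma solution_operator_contracts: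
  assumes "\<alpha> \<ge> 1" "zero_const_term y" "zero_const_term z"
    and "\<And>k. vanishes_below (v + 1) (y $ k - z $ k)"
  shows "vanishes_below (v + 2)
    (solution_operator q \<alpha> c B y $ l - solution_operator q \<alpha> c B z $ l)"
proof -
  have qd: "fps_X ^ \<alpha> * qderiv_x q f - fps_X ^ \<alpha> * qderiv_x q g = fps_X ^ \<alpha> * qderiv_x q (f - g)"
    for f g by (rule coeff2_eqI) (simp add: coeff2_eps_power_qderiv right_diff_distrib del: fps_mult_nth)
  have "solution_operator q \<alpha> c B y $ l - solution_operator q \<alpha> c B z $ l
      = (const_matrix B *v (\<chi> k. fps_X ^ \<alpha> * qderiv_x q (y $ k - z $ k) -
          (formal_compose (nonlinear_part c) y $ k - formal_compose (nonlinear_part c) z $ k))) $ l"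
    unfolding solution_operator_def vector_minus_component[symmetric]
      matrix_vector_mult_diff_distrib[symmetric]
    by (intro arg_cong[of _ _ "\<lambda>u. (const_matrix B *v u) $ l"])
      (simp add: vec_eq_iff flip: qd)
  moreover have "vanishes_below (v + 2) (fps_X ^ \<alpha> * qderiv_x q (y $ k - z $ k) -
      (formal_compose (nonlinear_part c) y $ k - formal_compose (nonlinear_part c) z $ k))" for k
    using vanishes_below_eps_power_qderiv[OF assms(4,1), of q k]
      formal_compose_nonlinear_close[OF assms(2-4), of c k] vanishes_below_diff by simp
  ultimately show ?thesis by (simp add: vanishes_below_const_matrix_mult)
qed

lemma zero_const_term_solution_operator:
  assumes "\<alpha> \<ge> 1" "zero_const_term y" "c (0, 0, \<lambda>_. 0) = 0"
  shows "zero_const_term (solution_operator q \<alpha> c B y)"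
proof -
  have "coeff2 (formal_compose (nonlinear_part c) y $ k) 0 0 = 0" for k
  proof -
    have "nonlinear_part c d = 0" if "monomial_weight d \<le> 0" for d
    proof -
      have "d = (0, 0, \<lambda>_. 0)" using that by (cases d) (auto simp: monomial_weight_def)
      then show ?thesis using assms(3) by (simp add: nonlinear_part_def)
    qed
    then show ?thesis
      using coeff2_formal_compose[OF assms(2), of 0 0 0] by simp
  qed
  then have "vanishes_below 1 (((\<chi> k. fps_X ^ \<alpha> * qderiv_x q (y $ k))
      - formal_compose (nonlinear_part c) y) $ k)" for k
    using assms(1) by (simp add: vanishes_below_1_iff)
  then show ?thesis
    unfolding zero_const_term_iff solution_operator_def
    by (intro allI vanishes_below_const_matrix_mult)
qed

definition iterate where
  "iterate q \<alpha> c B i = (solution_operator q \<alpha> c B ^^ i) 0"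

lemma zero_const_term_iterate:
  assumes "\<alpha> \<ge> 1" "c (0, 0, \<lambda>_. 0) = 0"
  shows "zero_const_term (iterate q \<alpha> c B i)"
  using zero_const_term_solution_operator[of \<alpha> _ c q B] assms
  by (induction i) (simp_all add: iterate_def zero_const_term_def[of 0])

text \<open>
  The coefficients of weight at most \<open>i\<close> do not change any more after the \<open>i\<close>-th iterate, since each
  application of the operator adds one order to the difference of two iterates.
\<close>
lemma iterate_stable:
  assumes "\<alpha> \<ge> 1" "c (0, 0, \<lambda>_. 0) = 0" "i \<le> j"
  shows "vanishes_below (i + 1) (iterate q \<alpha> c B j $ l - iterate q \<alpha> c B i $ l)"
  using assms(3)
proof (induction i arbitrary: j l)
  case 0
  then show ?case
    using zero_const_term_iterate[of \<alpha> c q B, OF assms(1,2)]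
    by (simp add: zero_const_term_iff iterate_def[of _ _ _ _ 0])
next
  case (Suc i)
  then obtain j' where j: "j = Suc j'" "i \<le> j'" by (cases j) auto
  have "vanishes_below (i + 2) (solution_operator q \<alpha> c B (iterate q \<alpha> c B j') $ l
      - solution_operator q \<alpha> c B (iterate q \<alpha> c B i) $ l)"
    by (intro solution_operator_contracts assms zero_const_term_iterate Suc.IH j)
  then show ?case by (simp add: j iterate_def)
qed

text \<open>
  By \<open>iterate_stable\<close> the coefficient of weight \<open>2n + k\<close> is final in the iterate with that number.
\<close>
definition limit_solution :: "complex \<Rightarrow> nat \<Rightarrow> (nat \<times> nat \<times> ('n::finite \<Rightarrow> nat) \<Rightarrow> complex ^ 'n)
    \<Rightarrow> complex ^ 'n ^ 'n \<Rightarrow> complex fps fps ^ 'n" where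
  "limit_solution q \<alpha> c B =
    (\<chi> l. Abs_fps (\<lambda>n. Abs_fps (\<lambda>k. coeff2 (iterate q \<alpha> c B (2 * n + k) $ l) n k)))"

lemma limit_solution_close_to_iterate:
  assumes "\<alpha> \<ge> 1" "c (0, 0, \<lambda>_. 0) = 0"
  shows "vanishes_below (i + 1) (limit_solution q \<alpha> c B $ l - iterate q \<alpha> c B i $ l)"
  unfolding vanishes_below_def
proof (intro allI impI)
  fix n k assume "2 * n + k < i + 1"
  then show "coeff2 (limit_solution q \<alpha> c B $ l - iterate q \<alpha> c B i $ l) n k = 0"
    using iterate_stable[of \<alpha> c "2 * n + k" i q B l, OF assms]
    by (simp add: limit_solution_def vanishes_below_def)
qed

lemma limit_solution_fixed_point:
  assumes "\<alpha> \<ge> 1" "c (0, 0, \<lambda>_. 0) = 0"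
  shows "zero_const_term (limit_solution q \<alpha> c B)"
    and "solution_operator q \<alpha> c B (limit_solution q \<alpha> c B) = limit_solution q \<alpha> c B"
proof -
  let ?y = "limit_solution q \<alpha> c B" and ?T = "solution_operator q \<alpha> c B"
    and ?Y = "iterate q \<alpha> c B"
  show zero: "zero_const_term ?y"
    using limit_solution_close_to_iterate[of \<alpha> c 0 q B, OF assms]
    by (simp add: zero_const_term_iff iterate_def)
  have "vanishes_below w (?T ?y $ l - ?y $ l)" for w l
  proof -
    have "vanishes_below (w + 2) (?T ?y $ l - ?T (?Y w) $ l)"
      by (intro solution_operator_contracts assms zero zero_const_term_iterate
          limit_solution_close_to_iterate)
    moreover have "vanishes_below (w + 2) (?y $ l - ?T (?Y w) $ l)"
      using limit_solution_close_to_iterate[of \<alpha> c "w + 1" q B l, OF assms] by (simp add: iterate_def)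
    ultimately have "vanishes_below (w + 2)
        ((?T ?y $ l - ?T (?Y w) $ l) - (?y $ l - ?T (?Y w) $ l))"
      by (rule vanishes_below_diff)
    then have "vanishes_below (w + 2) (?T ?y $ l - ?y $ l)" by simp
    then show ?thesis by (rule vanishes_below_mono) simp
  qed
  from vanishes_below_all_imp_zero[OF this] show "?T ?y = ?y" by (simp add: vec_eq_iff)
qed

lemma fixed_point_unique:
  assumes "\<alpha> \<ge> 1" "zero_const_term y" "zero_const_term z"
    and "solution_operator q \<alpha> c B y = y" "solution_operator q \<alpha> c B z = z"
  shows "y = z"
proof -
  have *: "vanishes_below (v + 1) (y $ l - z $ l)" for v l
  proof (induction v arbitrary: l)
    case 0
    then show ?case using assms by (auto simp: zero_const_term_iff intro: vanishes_below_diff)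
  next
    case (Suc v)
    then show ?case using solution_operator_contracts[of \<alpha> y z v q c B l] assms by simp
  qed
  have "vanishes_below v (y $ l - z $ l)" for v l
    by (rule vanishes_below_mono[OF *[of v]]) simp
  from vanishes_below_all_imp_zero[OF this] show ?thesis by (simp add: vec_eq_iff)
qed

section \<open>The expected growth of the coefficients\<close>
lemma choose_two_superadditive: "(s choose 2) + (t choose 2) \<le> (s + t) choose 2"
  by (induction t) (simp_all add: numeral_2_eq_2)

text \<open>
  Passing from \<open>u\<^bsub>n-\<alpha>\<^esub>\<close> to \<open>u\<^sub>n\<close> costs one \<open>q\<close>-derivative, which shrinks the disc by the factor \<open>Q\<close>
  and multiplies the supremum by a constant times \<open>Q\<^bsup>t-1\<^esup>\<close> at the \<open>t\<close>-th step. The term \<open>t choose 2\<close> collects these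
  factors, and the term \<open>k t\<close> encodes the radius \<open>1 / Q\<^sup>t\<close>, as a growth of the \<open>k\<close>-th coefficient.
\<close>
definition growth :: "real \<Rightarrow> nat \<Rightarrow> nat \<Rightarrow> nat \<Rightarrow> real" where
  "growth Q \<alpha> n k = Q ^ (((n div \<alpha>) choose 2) + k * (n div \<alpha>))"

lemma growth_ge_one: "Q \<ge> 1 \<Longrightarrow> growth Q \<alpha> n k \<ge> 1"
  by (simp add: growth_def)

text \<open>
  Both \<open>t \<mapsto> t choose 2\<close> and \<open>n \<mapsto> \<lfloor>n / \<alpha>\<rfloor>\<close> are superadditive. This is what makes the norm below
  submultiplicative.
\<close>
lemma growth_supermultiplicative:
  assumes "Q \<ge> 1"
  shows "growth Q \<alpha> n k * growth Q \<alpha> n' k' \<le> growth Q \<alpha> (n + n') (k + k')"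
proof -
  let ?s = "n div \<alpha>" and ?t = "n' div \<alpha>" and ?u = "(n + n') div \<alpha>"
  have le: "?s + ?t \<le> ?u"
  proof (cases "\<alpha> = 0")
    case False
    have "(?s + ?t) * \<alpha> \<le> n + n'"
      unfolding distrib_right by (intro add_mono div_times_less_eq_dividend)
    then show ?thesis using False by (simp add: less_eq_div_iff_mult_less_eq)
  qed simp
  then obtain d where d: "?u = ?s + ?t + d" by (auto simp: le_iff_add)
  have "(?s choose 2) + (?t choose 2) \<le> ?u choose 2"
    using choose_two_superadditive[of ?s ?t] choose_two_superadditive[of "?s + ?t" d]
    unfolding d by linarith
  moreover have "k * ?s + k' * ?t \<le> (k + k') * ?u"
  proof -
    have "k * ?s \<le> k * ?u" "k' * ?t \<le> k' * ?u" using le by (intro mult_le_mono2; linarith)+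
    then show ?thesis unfolding distrib_right by (rule add_mono)
  qed
  ultimately have "(?s choose 2) + k * ?s + ((?t choose 2) + k' * ?t) \<le> (?u choose 2) + (k + k') * ?u"
    by linarith
  then show ?thesis
    unfolding growth_def power_add[symmetric] by (intro power_increasing assms)
qed

text \<open>
  With \<open>s = t - 1\<close> the exponents agree because \<open>(t choose 2) + k t = k + (s choose 2) + (k + 1) s\<close>.
\<close>
lemma growth_shift:
  assumes "\<alpha> \<ge> 1" "n \<ge> \<alpha>"
  shows "growth Q \<alpha> n k = Q ^ k * growth Q \<alpha> (n - \<alpha>) (Suc k)"
proof -
  define s where "s = (n - \<alpha>) div \<alpha>"
  have "n div \<alpha> = Suc s" using assms by (simp add: s_def le_div_geq)
  then show ?thesis
    unfolding growth_def s_def[symmetric] power_add[symmetric]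
    by (simp add: numeral_2_eq_2 algebra_simps)
qed

section \<open>A truncated weighted norm\<close>
definition norm_weight :: "real \<Rightarrow> nat \<Rightarrow> real \<Rightarrow> nat \<Rightarrow> nat \<Rightarrow> real" where
  "norm_weight Q \<alpha> \<eta> n k = \<eta> ^ (2 * n + k) / growth Q \<alpha> n k"

text \<open>
  The truncation keeps the sum finite, so that nothing has to be known about convergence before the
  bounds are proved; they will be uniform in \<open>w\<close>.
\<close>
definition truncated_norm :: "real \<Rightarrow> nat \<Rightarrow> real \<Rightarrow> nat \<Rightarrow> complex fps fps \<Rightarrow> real" where
  "truncated_norm Q \<alpha> \<eta> w f =
    (\<Sum>(n, k) | 2 * n + k \<le> w. cmod (coeff2 f n k) * norm_weight Q \<alpha> \<eta> n k)"

lemma finite_weight_le: "finite {(n, k). 2 * n + k \<le> (w :: nat)}"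
  by (rule finite_subset[of _ "{..w} \<times> {..w}"]) auto

context
  fixes Q \<eta> :: real and \<alpha> :: nat
  assumes Q: "Q \<ge> 1" and \<eta>: "0 < \<eta>"
begin

abbreviation (input) "\<phi> \<equiv> norm_weight Q \<alpha> \<eta>"
abbreviation (input) "N \<equiv> truncated_norm Q \<alpha> \<eta>"

lemma growth_pos: "growth Q \<alpha> n k > 0"
  using growth_ge_one[OF Q, of \<alpha> n k] by linarith

lemma norm_weight_pos: "norm_weight Q \<alpha> \<eta> n k > 0"
  using growth_pos \<eta> by (simp add: norm_weight_def)

lemma norm_weight_le: "norm_weight Q \<alpha> \<eta> n k \<le> \<eta> ^ (2 * n + k)"
  using growth_ge_one[OF Q, of \<alpha> n k] \<eta> by (simp add: norm_weight_def divide_le_eq)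

lemma norm_weight_submultiplicative: "\<phi> (n + n') (k + k') \<le> \<phi> n k * \<phi> n' k'"
proof -
  have "\<phi> (n + n') (k + k') \<le> \<eta> ^ (2 * (n + n') + (k + k')) / (growth Q \<alpha> n k * growth Q \<alpha> n' k')"
    unfolding norm_weight_def using \<eta> growth_pos
    by (intro divide_left_mono growth_supermultiplicative Q mult_pos_pos) auto
  also have "\<dots> = \<phi> n k * \<phi> n' k'"
    by (simp add: norm_weight_def power_add algebra_simps)
  finally show ?thesis .
qed

lemma truncated_norm_nonneg: "N w f \<ge> 0"
  unfolding truncated_norm_def
  by (intro sum_nonneg) (auto intro!: mult_nonneg_nonneg less_imp_le[OF norm_weight_pos])

lemma truncated_norm_zero: "N w 0 = 0"
  by (simp add: truncated_norm_def)

lemma truncated_norm_diff: "N w (f - g) \<le> N w f + N w g"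
  unfolding truncated_norm_def sum.distrib[symmetric]
proof (intro sum_mono, clarsimp)
  fix n k
  have "cmod (coeff2 f n k - coeff2 g n k) * \<phi> n k \<le> (cmod (coeff2 f n k) + cmod (coeff2 g n k)) * \<phi> n k"
    by (intro mult_right_mono norm_triangle_ineq4 less_imp_le[OF norm_weight_pos])
  then show "cmod (coeff2 f n k - coeff2 g n k) * \<phi> n k
      \<le> cmod (coeff2 f n k) * \<phi> n k + cmod (coeff2 g n k) * \<phi> n k"
    by (simp add: distrib_right)
qed

lemma truncated_norm_le_sum:
  assumes "\<And>n k. 2 * n + k \<le> w \<Longrightarrow> coeff2 f n k = (\<Sum>i\<in>I. a i * coeff2 (g i) n k)"
  shows "N w f \<le> (\<Sum>i\<in>I. cmod (a i) * N w (g i))"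
proof -
  have "N w f \<le> (\<Sum>(n, k) | 2 * n + k \<le> w. \<Sum>i\<in>I. cmod (a i) * (cmod (coeff2 (g i) n k) * \<phi> n k))"
    unfolding truncated_norm_def
  proof (intro sum_mono, clarsimp)
    fix n k assume "2 * n + k \<le> w"
    then have "cmod (coeff2 f n k) \<le> (\<Sum>i\<in>I. cmod (a i) * cmod (coeff2 (g i) n k))"
      using norm_sum[of "\<lambda>i. a i * coeff2 (g i) n k" I] by (simp add: assms norm_mult)
    then have "cmod (coeff2 f n k) * \<phi> n k \<le> (\<Sum>i\<in>I. cmod (a i) * cmod (coeff2 (g i) n k)) * \<phi> n k"
      by (intro mult_right_mono less_imp_le[OF norm_weight_pos])
    then show "cmod (coeff2 f n k) * \<phi> n k
        \<le> (\<Sum>i\<in>I. cmod (a i) * (cmod (coeff2 (g i) n k) * \<phi> n k))"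
      by (simp add: sum_distrib_right mult.assoc)
  qed
  also have "\<dots> = (\<Sum>i\<in>I. cmod (a i) * N w (g i))"
    unfolding truncated_norm_def sum_distrib_left
    by (subst sum.swap) (simp add: split_beta)
  finally show ?thesis .
qed

text \<open>The common bound for the three monomials \<open>1\<close>, \<open>x\<close> and \<open>\<epsilon>\<close>.\<close>
lemma truncated_norm_single:
  assumes "\<And>n k. n \<noteq> a \<or> k \<noteq> b \<Longrightarrow> coeff2 f n k = 0" "cmod (coeff2 f a b) \<le> 1"
  shows "N w f \<le> \<eta> ^ (2 * a + b)"
proof -
  have "N w f = (\<Sum>(n, k)\<in>{(n, k). 2 * n + k \<le> w} \<inter> {(a, b)}. cmod (coeff2 f n k) * \<phi> n k)"
    unfolding truncated_norm_def
  proof (rule sum.mono_neutral_right[OF finite_weight_le])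
    show "\<forall>p\<in>{(n, k). 2 * n + k \<le> w} - {(n, k). 2 * n + k \<le> w} \<inter> {(a, b)}.
        (case p of (n, k) \<Rightarrow> cmod (coeff2 f n k) * \<phi> n k) = 0"
      using assms(1) by fastforce
  qed auto
  also have "\<dots> \<le> cmod (coeff2 f a b) * \<phi> a b"
    using norm_weight_pos[of a b] by (cases "2 * a + b \<le> w") (auto simp: less_imp_le)
  also have "\<dots> \<le> 1 * \<eta> ^ (2 * a + b)"
    using assms(2) norm_weight_le norm_weight_pos by (intro mult_mono) (auto simp: less_imp_le)
  finally show ?thesis by simp
qed

lemma truncated_norm_one: "N w 1 \<le> 1"
  by (rule truncated_norm_single[of 0 0, THEN order_trans]) auto

lemma truncated_norm_x: "N w (fps_const fps_X) \<le> \<eta>"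
  by (rule truncated_norm_single[of 0 1, THEN order_trans]) (auto simp: fps_X_nth)

lemma truncated_norm_eps: "N w fps_X \<le> \<eta> ^ 2"
  by (rule truncated_norm_single[of 1 0, THEN order_trans]) (auto simp: fps_X_nth)

text \<open>
  The norm of the product is bounded by the part of the double sum in \<open>N w f * N w g\<close> that belongs
  to pairs of indices whose total weight is at most \<open>w\<close>.
\<close>
lemma truncated_norm_mult: "N w (f * g) \<le> N w f * N w g"
proof -
  let ?S = "{(n, k). 2 * n + k \<le> w}"
  let ?t = "\<lambda>f n k. cmod (coeff2 f n k) * \<phi> n k"
  let ?T = "Sigma ?S (\<lambda>(n, k). {..n} \<times> {..k})"
  let ?F = "\<lambda>(p, i, j). ?t f i j * ?t g (fst p - i) (snd p - j)"
  let ?G = "\<lambda>((i, j), (i', j')). ?t f i j * ?t g i' j'"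
  have "N w (f * g) \<le> (\<Sum>(n, k)\<in>?S. \<Sum>(i, j)\<in>{..n} \<times> {..k}. ?t f i j * ?t g (n - i) (k - j))"
  proof -
    have *: "cmod (coeff2 (f * g) n k) * \<phi> n k
        \<le> (\<Sum>(i, j)\<in>{..n} \<times> {..k}. ?t f i j * ?t g (n - i) (k - j))" for n k
    proof -
      have "cmod (coeff2 (f * g) n k) * \<phi> n k
          \<le> (\<Sum>(i, j)\<in>{..n} \<times> {..k}. cmod (coeff2 f i j * coeff2 g (n - i) (k - j))) * \<phi> n k"
        unfolding coeff2_mult sum.cartesian_product
        by (intro mult_right_mono less_imp_le[OF norm_weight_pos] sum_norm_le) auto
      also have "\<dots> \<le> (\<Sum>(i, j)\<in>{..n} \<times> {..k}. ?t f i j * ?t g (n - i) (k - j))"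
        unfolding sum_distrib_right
      proof (intro sum_mono, clarsimp)
        fix i j assume "i \<le> n" "j \<le> k"
        then have "\<phi> n k \<le> \<phi> i j * \<phi> (n - i) (k - j)"
          using norm_weight_submultiplicative[of i "n - i" j "k - j"] by simp
        then have "cmod (coeff2 f i j * coeff2 g (n - i) (k - j)) * \<phi> n k
            \<le> cmod (coeff2 f i j * coeff2 g (n - i) (k - j)) * (\<phi> i j * \<phi> (n - i) (k - j))"
          by (intro mult_left_mono) auto
        then show "cmod (coeff2 f i j * coeff2 g (n - i) (k - j)) * \<phi> n k
            \<le> ?t f i j * ?t g (n - i) (k - j)"
          by (simp add: norm_mult mult_ac)
      qed
      finally show ?thesis .
    qed
    show ?thesis
      unfolding truncated_norm_def by (intro sum_mono, clarify) (simp only: prod.case *)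
  qed
  also have "\<dots> = sum ?F ?T"
    using finite_weight_le by (subst sum.Sigma[symmetric]) (auto simp: split_beta)
  also have "\<dots> \<le> sum ?G (?S \<times> ?S)"
  proof (rule sum_le_included[where i = "\<lambda>((i, j), (i', j')). ((i + i', j + j'), (i, j))"])
    show "finite ?T" using finite_weight_le by (intro finite_SigmaI) auto
    show "finite (?S \<times> ?S)" using finite_weight_le by simp
    show "\<forall>y\<in>?S \<times> ?S. 0 \<le> ?G y"
      by (auto intro!: mult_nonneg_nonneg less_imp_le[OF norm_weight_pos])
    show "\<forall>x\<in>?T. \<exists>y\<in>?S \<times> ?S.
        (\<lambda>((i, j), (i', j')). ((i + i', j + j'), (i, j))) y = x \<and> ?F x \<le> ?G y"
    proof
      fix x assume "x \<in> ?T"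
      then obtain n k i j where "x = ((n, k), (i, j))" "2 * n + k \<le> w" "i \<le> n" "j \<le> k"
        by auto
      then show "\<exists>y\<in>?S \<times> ?S.
          (\<lambda>((i, j), (i', j')). ((i + i', j + j'), (i, j))) y = x \<and> ?F x \<le> ?G y"
        by (intro bexI[of _ "((i, j), (n - i, k - j))"]) auto
    qed
  qed
  also have "\<dots> = N w f * N w g"
    unfolding truncated_norm_def sum_product sum.cartesian_product by (simp add: split_beta)
  finally show ?thesis .
qed

lemma truncated_norm_mult_le: "N w f \<le> a \<Longrightarrow> N w g \<le> b \<Longrightarrow> N w (f * g) \<le> a * b"
  using truncated_norm_mult[of w f g] mult_mono[of "N w f" a "N w g" b]
    truncated_norm_nonneg[of w f] truncated_norm_nonneg[of w g] by linarith

lemma truncated_norm_power: "N w f \<le> a \<Longrightarrow> N w (f ^ n) \<le> a ^ n"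
  by (induction n) (auto simp: truncated_norm_one intro: truncated_norm_mult_le)

lemma truncated_norm_prod:
  "finite I \<Longrightarrow> (\<And>i. i \<in> I \<Longrightarrow> N w (f i) \<le> a i) \<Longrightarrow> N w (\<Prod>i\<in>I. f i) \<le> (\<Prod>i\<in>I. a i)"
  by (induction I rule: finite_induct) (auto simp: truncated_norm_one intro: truncated_norm_mult_le)

lemma truncated_norm_formal_monomial:
  assumes "\<And>k. N w (y $ k) \<le> \<delta>"
  shows "N w (formal_monomial y (i, j, m)) \<le> \<eta> ^ i * (\<eta> ^ 2) ^ j * \<delta> ^ (\<Sum>k\<in>UNIV. m k)"
  unfolding formal_monomial_def prod.case power_sum
  by (intro truncated_norm_mult_le truncated_norm_power truncated_norm_x truncated_norm_eps
      truncated_norm_prod assms) auto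

text \<open>
  The factor \<open>[k + 1]\<^sub>q\<close> has size at most a constant times \<open>Q\<^sup>k\<close>, and \<open>growth_shift\<close> absorbs exactly
  \<open>Q\<^sup>k\<close>. The weight drops by \<open>2\<alpha> - 1 \<ge> 1\<close> from the new coefficient to the old one, which leaves a
  factor \<open>\<eta>\<close>; no weight above \<open>w\<close> is ever consulted.
\<close>
lemma truncated_norm_eps_power_qderiv:
  assumes "Q = cmod q" "q \<noteq> 1" "\<alpha> \<ge> 1" "\<eta> \<le> 1"
  shows "N w (fps_X ^ \<alpha> * qderiv_x q f) \<le> 2 * Q / cmod (q - 1) * \<eta> * N w f"
proof -
  define C where "C = 2 * Q / cmod (q - 1)"
  have C: "C \<ge> 0" using Q by (simp add: C_def)
  let ?S = "{(n, k). 2 * n + k \<le> w}"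
  let ?t = "\<lambda>f n k. cmod (coeff2 f n k) * \<phi> n k"
  have qnum: "cmod (qnum q (Suc k)) \<le> C * Q ^ k" for k
  proof -
    have "cmod (q ^ Suc k - 1) \<le> Q ^ Suc k + 1"
      using norm_triangle_ineq4[of "q ^ Suc k" 1] by (simp add: norm_power norm_mult assms(1))
    also have "\<dots> \<le> 2 * Q * Q ^ k" using one_le_power[OF Q, of "Suc k"] by simp
    finally show ?thesis
      unfolding qnum_def norm_divide C_def using assms(2)
      by (simp add: divide_right_mono)
  qed
  have shift: "cmod (qnum q (Suc k)) * \<phi> n k \<le> C * \<eta> * \<phi> (n - \<alpha>) (Suc k)" if "n \<ge> \<alpha>" for n k
  proof -
    have "\<eta> ^ (2 * n + k) = \<eta> ^ (2 * (n - \<alpha>) + Suc k) * \<eta> ^ (2 * \<alpha> - 1)"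
      unfolding power_add[symmetric] using that assms(3) by (intro arg_cong[of _ _ "power \<eta>"]) simp
    also have "\<dots> \<le> \<eta> ^ (2 * (n - \<alpha>) + Suc k) * \<eta> ^ 1"
      using assms(3,4) \<eta> by (intro mult_left_mono power_decreasing) auto
    finally have pow: "\<eta> ^ (2 * n + k) \<le> \<eta> * \<eta> ^ (2 * (n - \<alpha>) + Suc k)" by (simp add: mult.commute)
    have "cmod (qnum q (Suc k)) * \<phi> n k \<le> C * Q ^ k * \<phi> n k"
      by (intro mult_right_mono qnum less_imp_le[OF norm_weight_pos])
    also have "\<dots> = C * (\<eta> ^ (2 * n + k) / growth Q \<alpha> (n - \<alpha>) (Suc k))"
      using Q by (simp add: norm_weight_def growth_shift[OF assms(3) that])
    also have "\<dots> \<le> C * (\<eta> * \<eta> ^ (2 * (n - \<alpha>) + Suc k) / growth Q \<alpha> (n - \<alpha>) (Suc k))"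
      by (intro mult_left_mono divide_right_mono pow C less_imp_le[OF growth_pos])
    finally show ?thesis by (simp add: norm_weight_def)
  qed
  have "N w (fps_X ^ \<alpha> * qderiv_x q f)
      = (\<Sum>(n, k)\<in>?S \<inter> {\<alpha>..} \<times> UNIV. cmod (coeff2 (fps_X ^ \<alpha> * qderiv_x q f) n k) * \<phi> n k)"
    unfolding truncated_norm_def
    by (rule sum.mono_neutral_right[OF finite_weight_le])
      (auto simp del: fps_mult_nth simp: coeff2_eps_power_qderiv split: if_splits)
  also have "\<dots> \<le> (\<Sum>(n, k)\<in>?S. C * \<eta> * ?t f n k)"
  proof (rule sum_le_included[where i = "\<lambda>(n, k). (n + \<alpha>, k - 1)"])
    show "\<forall>y\<in>?S. 0 \<le> (case y of (n, k) \<Rightarrow> C * \<eta> * ?t f n k)"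
      using C \<eta> by (auto intro!: mult_nonneg_nonneg less_imp_le[OF norm_weight_pos])
    show "\<forall>x\<in>?S \<inter> {\<alpha>..} \<times> UNIV. \<exists>y\<in>?S. (case y of (n, k) \<Rightarrow> (n + \<alpha>, k - 1)) = x \<and>
        (case x of (n, k) \<Rightarrow> cmod (coeff2 (fps_X ^ \<alpha> * qderiv_x q f) n k) * \<phi> n k)
          \<le> (case y of (n, k) \<Rightarrow> C * \<eta> * ?t f n k)"
    proof
      fix x assume "x \<in> ?S \<inter> {\<alpha>..} \<times> (UNIV :: nat set)"
      then obtain n k where x: "x = (n, k)" and nk: "2 * n + k \<le> w" "n \<ge> \<alpha>" by auto
      have "cmod (coeff2 (fps_X ^ \<alpha> * qderiv_x q f) n k) * \<phi> n k
          = cmod (coeff2 f (n - \<alpha>) (Suc k)) * (cmod (qnum q (Suc k)) * \<phi> n k)"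
        using nk by (simp del: fps_mult_nth add: coeff2_eps_power_qderiv norm_mult)
      also have "\<dots> \<le> cmod (coeff2 f (n - \<alpha>) (Suc k)) * (C * \<eta> * \<phi> (n - \<alpha>) (Suc k))"
        by (intro mult_left_mono shift nk) auto
      finally show "\<exists>y\<in>?S. (case y of (n, k) \<Rightarrow> (n + \<alpha>, k - 1)) = x \<and>
          (case x of (n, k) \<Rightarrow> cmod (coeff2 (fps_X ^ \<alpha> * qderiv_x q f) n k) * \<phi> n k)
          \<le> (case y of (n, k) \<Rightarrow> C * \<eta> * ?t f n k)"
        using nk assms(3) by (intro bexI[of _ "(n - \<alpha>, Suc k)"]) (auto simp: x mult_ac)
    qed
  qed (use finite_weight_le in auto)
  also have "\<dots> = C * \<eta> * N w f"
    by (simp add: truncated_norm_def sum_distrib_left split_beta)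
  finally show ?thesis by (simp add: C_def)
qed

text \<open>
  A monomial with a factor \<open>x\<close> or \<open>\<epsilon>\<close> contributes a factor \<open>\<eta> / \<rho>\<close> relative to its value at the radius
  \<open>\<rho>\<close>. The others are at least quadratic in \<open>y\<close>, since the constant and the linear terms are absent, and
  contribute \<open>(\<delta> / \<rho>)\<^sup>2\<close>.
\<close>
lemma truncated_norm_nonlinear_part:
  assumes y: "zero_const_term y" "\<And>k. N w (y $ k) \<le> \<delta>"
    and c0: "c (0, 0, \<lambda>_. 0) = 0"
    and c: "\<And>D. finite D \<Longrightarrow> (\<Sum>(i, j, m)\<in>D. cmod (c (i, j, m) $ l) * \<rho> ^ (i + j + (\<Sum>k\<in>UNIV. m k))) \<le> M"
    and \<delta>: "0 \<le> \<delta>" "\<delta> \<le> \<rho>" and \<eta>': "\<eta> \<le> \<rho>" "\<eta> \<le> 1"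
  shows "N w (formal_compose (nonlinear_part c) y $ l) \<le> M * (\<eta> / \<rho> + (\<delta> / \<rho>) ^ 2)"
proof -
  let ?D = "{d :: nat \<times> nat \<times> ('a \<Rightarrow> nat). monomial_weight d \<le> w}"
  have \<rho>: "\<rho> > 0" using \<eta> \<eta>' by simp
  define b where "b = \<eta> / \<rho> + (\<delta> / \<rho>) ^ 2"
  have b: "b \<ge> 0" using \<rho> \<eta> by (simp add: b_def)
  have "N w (formal_compose (nonlinear_part c) y $ l)
      \<le> (\<Sum>d\<in>?D. cmod (nonlinear_part c d $ l) * N w (formal_monomial y d))"
    by (rule truncated_norm_le_sum) (rule coeff2_formal_compose[OF y(1)])
  also have "\<dots> \<le> (\<Sum>(i, j, m)\<in>?D. cmod (c (i, j, m) $ l) * \<rho> ^ (i + j + (\<Sum>k\<in>UNIV. m k)) * b)"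
  proof (intro sum_mono, clarify)
    fix i j and m :: "'a \<Rightarrow> nat"
    let ?s = "\<Sum>k\<in>UNIV. m k"
    show "cmod (nonlinear_part c (i, j, m) $ l) * N w (formal_monomial y (i, j, m))
        \<le> cmod (c (i, j, m) $ l) * \<rho> ^ (i + j + ?s) * b"
    proof (cases "(i, j, m) \<in> range linear_index \<or> c (i, j, m) = 0")
      case True
      then show ?thesis using \<rho> b by (auto simp: nonlinear_part_def)
    next
      case False
      have "\<eta> ^ i * (\<eta> ^ 2) ^ j * \<delta> ^ ?s \<le> \<rho> ^ (i + j + ?s) * b"
      proof (cases "i + j = 0")
        case True
        have "?s \<ge> 2"
        proof (rule ccontr)
          assume "\<not> ?s \<ge> 2"
          then have "m = (\<lambda>_. 0)" using weight_one_cases[of i j m] False True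
            by (simp add: monomial_weight_def)
          with False True c0 show False by simp
        qed
        then obtain s where s: "?s = 2 + s" by (auto simp: le_iff_add)
        have "\<delta> ^ ?s = \<delta> ^ 2 * \<delta> ^ s" by (simp only: s power_add)
        also have "\<dots> \<le> \<delta> ^ 2 * \<rho> ^ s" using \<delta> by (intro mult_left_mono power_mono) auto
        also have "\<dots> = \<rho> ^ ?s * (\<delta> / \<rho>) ^ 2" using \<rho> by (simp add: s power_add power_divide power2_eq_square)
        also have "\<dots> \<le> \<rho> ^ ?s * b" using \<rho> \<eta> by (intro mult_left_mono) (auto simp: b_def)
        finally show ?thesis using True by simp
      next
        case F: False
        then obtain p where p: "i + j = Suc p" by (cases "i + j") auto
        have "\<eta> ^ i * (\<eta> ^ 2) ^ j = \<eta> ^ (i + 2 * j)" by (simp add: power_add power_mult)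
        also have "\<dots> \<le> \<eta> ^ (i + j)" using \<eta> \<eta>' by (intro power_decreasing) auto
        also have "\<dots> = \<eta> * \<eta> ^ p" by (simp add: p)
        also have "\<dots> \<le> \<eta> * \<rho> ^ p" using \<eta> \<eta>' by (intro mult_left_mono power_mono) auto
        also have "\<dots> = \<rho> ^ (i + j) * (\<eta> / \<rho>)" using \<rho> by (simp add: p)
        also have "\<dots> \<le> \<rho> ^ (i + j) * b" using \<rho> by (intro mult_left_mono) (auto simp: b_def)
        finally have "\<eta> ^ i * (\<eta> ^ 2) ^ j * \<delta> ^ ?s \<le> (\<rho> ^ (i + j) * b) * \<rho> ^ ?s"
          by (rule mult_mono) (use \<delta> \<rho> b in \<open>auto intro: power_mono\<close>)
        then show ?thesis by (simp add: power_add mult_ac)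
      qed
      then have "N w (formal_monomial y (i, j, m)) \<le> \<rho> ^ (i + j + ?s) * b"
        using truncated_norm_formal_monomial[OF y(2), of i j m] by linarith
      then show ?thesis
        unfolding mult.assoc using False
        by (intro mult_mono truncated_norm_nonneg) (auto simp: nonlinear_part_def)
    qed
  qed
  also have "\<dots> = (\<Sum>(i, j, m)\<in>?D. cmod (c (i, j, m) $ l) * \<rho> ^ (i + j + (\<Sum>k\<in>UNIV. m k))) * b"
    by (simp add: sum_distrib_right split_beta)
  also have "\<dots> \<le> M * b"
    by (intro mult_right_mono c b finite_monomial_weight_le)
  finally show ?thesis by (simp add: b_def)
qed

end

section \<open>Uniform bounds for the solution\<close>

text \<open>
  First \<open>\<delta>\<close> is chosen so small that the quadratic term uses up at most one half of \<open>\<delta>\<close>. The other terms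
  are linear in \<open>\<eta>\<close>, and \<open>\<eta>\<close> is chosen after \<open>\<delta>\<close> to make them at most the other half.
\<close>
lemma small_parameters:
  fixes \<rho> K L M :: real
  assumes "\<rho> > 0" "K \<ge> 0" "L \<ge> 0" "M \<ge> 0"
  obtains \<delta> \<eta> where "0 < \<delta>" "\<delta> \<le> \<rho>" "0 < \<eta>" "\<eta> \<le> \<rho>" "\<eta> \<le> 1"
    "K * (L * \<eta> * \<delta> + M * (\<eta> / \<rho> + (\<delta> / \<rho>) ^ 2)) \<le> \<delta>"
proof -
  define \<delta> where "\<delta> = min \<rho> (\<rho> ^ 2 / (2 * (K * M + 1)))"
  define E where "E = K * (L * \<delta> + M / \<rho>)"
  define \<eta> where "\<eta> = min (min \<rho> 1) (\<delta> / (2 * (E + 1)))"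
  have KM: "K * M \<ge> 0" using assms by simp
  have "0 < 2 * (K * M + 1)" using KM by (simp only: zero_less_mult_iff) simp
  then have "0 < \<rho> ^ 2 / (2 * (K * M + 1))" by (intro divide_pos_pos) (use assms in simp)
  then have \<delta>: "0 < \<delta>" "\<delta> \<le> \<rho>" using assms by (auto simp: \<delta>_def)
  have E: "E \<ge> 0" using assms \<delta> by (simp add: E_def)
  have \<eta>: "0 < \<eta>" "\<eta> \<le> \<rho>" "\<eta> \<le> 1"
    using assms \<delta> E by (auto simp: \<eta>_def intro!: divide_pos_pos)
  have "\<delta> * (2 * (K * M + 1)) \<le> \<rho> ^ 2"
    using KM by (subst pos_le_divide_eq[symmetric]) (auto simp: \<delta>_def)
  then have "K * M * \<delta> \<le> \<rho> ^ 2 / 2" using \<delta> by (simp add: algebra_simps)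
  then have "K * M * \<delta> * \<delta> \<le> \<rho> ^ 2 / 2 * \<delta>" using \<delta> by (intro mult_right_mono) auto
  then have quadratic: "K * M * (\<delta> / \<rho>) ^ 2 \<le> \<delta> / 2"
    using assms(1) by (simp add: power_divide power2_eq_square field_simps)
  have "\<eta> * (2 * (E + 1)) \<le> \<delta>"
    using E by (subst pos_le_divide_eq[symmetric]) (auto simp: \<eta>_def)
  then have "\<eta> * E \<le> \<delta> / 2" using \<eta> by (simp add: algebra_simps)
  with quadratic have "\<eta> * E + K * M * (\<delta> / \<rho>) ^ 2 \<le> \<delta>" by linarith
  also have "\<eta> * E + K * M * (\<delta> / \<rho>) ^ 2 = K * (L * \<eta> * \<delta> + M * (\<eta> / \<rho> + (\<delta> / \<rho>) ^ 2))"
    by (simp add: E_def algebra_simps)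
  finally show ?thesis using that \<delta> \<eta> by blast
qed

text \<open>
  The assumption \<open>small\<close> makes the operator map the ball of radius \<open>\<delta>\<close> to itself, at every
  truncation level.
\<close>
lemma truncated_norm_iterate:
  fixes c :: "nat \<times> nat \<times> ('n::finite \<Rightarrow> nat) \<Rightarrow> complex ^ 'n"
  assumes q: "cmod q > 1" and \<alpha>: "\<alpha> \<ge> 1" and c0: "c (0, 0, \<lambda>_. 0) = 0"
    and c: "\<And>D l. finite D \<Longrightarrow>
      (\<Sum>(i, j, m)\<in>D. cmod (c (i, j, m) $ l) * \<rho> ^ (i + j + (\<Sum>k\<in>UNIV. m k))) \<le> M"
    and B: "\<And>l. (\<Sum>k\<in>UNIV. cmod (B $ l $ k)) \<le> K"
    and \<delta>: "0 < \<delta>" "\<delta> \<le> \<rho>" and \<eta>: "0 < \<eta>" "\<eta> \<le> \<rho>" "\<eta> \<le> 1"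
    and small: "K * (2 * cmod q / cmod (q - 1) * \<eta> * \<delta> + M * (\<eta> / \<rho> + (\<delta> / \<rho>) ^ 2)) \<le> \<delta>"
  shows "truncated_norm (cmod q) \<alpha> \<eta> w (iterate q \<alpha> c B i $ l) \<le> \<delta>"
proof (induction i arbitrary: l)
  case 0
  then show ?case using \<delta> q \<eta> by (simp add: iterate_def truncated_norm_zero[of "cmod q" \<eta>])
next
  case (Suc i)
  have Q: "1 \<le> cmod q" "q \<noteq> 1" using q by auto
  let ?N = "truncated_norm (cmod q) \<alpha> \<eta>" and ?y = "iterate q \<alpha> c B i"
  define b where "b = 2 * cmod q / cmod (q - 1) * \<eta> * \<delta> + M * (\<eta> / \<rho> + (\<delta> / \<rho>) ^ 2)"
  define v where "v = (\<chi> k. fps_X ^ \<alpha> * qderiv_x q (?y $ k)) - formal_compose (nonlinear_part c) ?y"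
  have v: "?N w (v $ k) \<le> b" for k
  proof -
    have "?N w (v $ k) \<le> ?N w (fps_X ^ \<alpha> * qderiv_x q (?y $ k))
        + ?N w (formal_compose (nonlinear_part c) ?y $ k)"
      unfolding v_def vector_minus_component vec_lambda_beta
      by (rule truncated_norm_diff[OF Q(1) \<eta>(1)])
    also have "\<dots> \<le> 2 * cmod q / cmod (q - 1) * \<eta> * ?N w (?y $ k) + M * (\<eta> / \<rho> + (\<delta> / \<rho>) ^ 2)"
      using \<delta> \<eta> \<alpha> c0 Q Suc.IH
      by (intro add_mono truncated_norm_eps_power_qderiv truncated_norm_nonlinear_part c
          zero_const_term_iterate) auto
    also have "\<dots> \<le> b"
      unfolding b_def using \<eta> by (intro add_right_mono mult_left_mono Suc.IH) auto
    finally show ?thesis .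
  qed
  have b: "b \<ge> 0" using v[of undefined] truncated_norm_nonneg[OF Q(1) \<eta>(1), of \<alpha> w "v $ undefined"] by linarith
  have "?N w (iterate q \<alpha> c B (Suc i) $ l) = ?N w ((const_matrix B *v v) $ l)"
    by (simp add: iterate_def solution_operator_def v_def)
  also have "\<dots> \<le> (\<Sum>k\<in>UNIV. cmod (B $ l $ k) * ?N w (v $ k))"
    by (rule truncated_norm_le_sum[OF Q(1) \<eta>(1)]) (rule coeff2_const_matrix_mult)
  also have "\<dots> \<le> (\<Sum>k\<in>UNIV. cmod (B $ l $ k) * b)"
    by (intro sum_mono mult_left_mono v) auto
  also have "\<dots> \<le> K * b"
    unfolding sum_distrib_right[symmetric] by (intro mult_right_mono B b)
  also have "\<dots> \<le> \<delta>" using small by (simp add: b_def)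
  finally show ?case .
qed

lemma coeff2_le_truncated_norm:
  assumes "Q \<ge> 1" "0 < \<eta>"
  shows "cmod (coeff2 f n k) \<le> growth Q \<alpha> n k / \<eta> ^ (2 * n + k) * truncated_norm Q \<alpha> \<eta> (2 * n + k) f"
proof -
  let ?\<phi> = "norm_weight Q \<alpha> \<eta>"
  have "(\<lambda>(n, k). cmod (coeff2 f n k) * ?\<phi> n k) (n, k) \<le> truncated_norm Q \<alpha> \<eta> (2 * n + k) f"
    unfolding truncated_norm_def 
    by (intro member_le_sum finite_weight_le)
      (auto intro!: mult_nonneg_nonneg less_imp_le[OF norm_weight_pos[OF assms]])
  moreover have "?\<phi> n k > 0" "growth Q \<alpha> n k / \<eta> ^ (2 * n + k) = 1 / ?\<phi> n k"
    using norm_weight_pos[OF assms] by (auto simp: norm_weight_def)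
  ultimately show ?thesis by (simp add: pos_le_divide_eq)
qed

lemma limit_solution_coeff_bound:
  assumes "Q \<ge> 1" "0 < \<eta>" "\<And>w i. truncated_norm Q \<alpha> \<eta> w (iterate q \<alpha> c B i $ l) \<le> \<delta>"
  shows "cmod (coeff2 (limit_solution q \<alpha> c B $ l) n k)
    \<le> \<delta> * Q ^ ((n div \<alpha>) choose 2) * (1 / \<eta> ^ 2) ^ n * (Q ^ (n div \<alpha>) / \<eta>) ^ k"
proof -
  have "cmod (coeff2 (limit_solution q \<alpha> c B $ l) n k) =
      cmod (coeff2 (iterate q \<alpha> c B (2 * n + k) $ l) n k)"
    by (simp add: limit_solution_def)
  also have "\<dots> \<le> growth Q \<alpha> n k / \<eta> ^ (2 * n + k) *
      truncated_norm Q \<alpha> \<eta> (2 * n + k) (iterate q \<alpha> c B (2 * n + k) $ l)"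
    by (rule coeff2_le_truncated_norm[OF assms(1,2)])
  also have "\<dots> \<le> growth Q \<alpha> n k / \<eta> ^ (2 * n + k) * \<delta>"
    using growth_pos[OF assms(1,2)] assms(2) by (intro mult_left_mono assms(3)) (auto simp: less_imp_le)
  also have "\<dots> = \<delta> * Q ^ ((n div \<alpha>) choose 2) * (1 / \<eta> ^ 2) ^ n * (Q ^ (n div \<alpha>) / \<eta>) ^ k"
    by (simp add: growth_def power_add power_divide mult.commute flip: power_mult)
  finally show ?thesis .
qed

text \<open>
  The radius is half of the natural one, so that the power series is dominated by \<open>a \<Sum> 2\<^bsup>-k\<^esup> = 2a\<close>.
\<close>
lemma geometric_coeffs_imp_bounded:
  fixes f :: "complex fps"
  assumes f: "\<And>k. cmod (fps_nth f k) \<le> a * s ^ k" and s: "s > 0"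
  shows "in_Ob (1 / (2 * s)) f"
    and "\<And>x. x \<in> ball 0 (1 / (2 * s)) \<Longrightarrow> cmod (eval_fps f x) \<le> 2 * a"
proof -
  have a: "a \<ge> 0" using order_trans[OF norm_ge_zero f[of 0]] by simp
  have le: "norm (fps_nth f k * x ^ k) \<le> a * (1 / 2) ^ k" if "cmod x \<le> 1 / (2 * s)" for x k
  proof -
    have "norm (fps_nth f k * x ^ k) \<le> (a * s ^ k) * (1 / (2 * s)) ^ k"
      unfolding norm_mult norm_power using a s that by (intro mult_mono f power_mono) auto
    also have "\<dots> = a * (1 / 2) ^ k" using s by (simp add: power_mult_distrib power_divide)
    finally show ?thesis .
  qed
  have geo: "(\<lambda>k. a * (1 / 2) ^ k) sums (a * 2)"
    using sums_mult[OF geometric_sums[of "1 / 2 :: real"], of a] by simp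
  have summ: "summable (\<lambda>k. fps_nth f k * x ^ k)" if "cmod x \<le> 1 / (2 * s)" for x
    by (rule summable_comparison_test'[OF sums_summable[OF geo]]) (rule le[OF that])
  show bound: "cmod (eval_fps f x) \<le> 2 * a" if "x \<in> ball 0 (1 / (2 * s))" for x
  proof -
    have "cmod (suminf (\<lambda>k. fps_nth f k * x ^ k)) \<le> suminf (\<lambda>k. a * (1 / 2) ^ k)"
      using that by (intro norm_suminf_le le sums_summable[OF geo]) auto
    then show ?thesis using sums_unique[OF geo] by (simp add: eval_fps_def)
  qed
  have "fps_conv_radius f \<ge> norm (complex_of_real (1 / (2 * s)))"
    unfolding fps_conv_radius_def using s by (intro conv_radius_geI summ) (simp add: norm_divide)
  then have "ball 0 (1 / (2 * s)) \<subseteq> eball 0 (fps_conv_radius f)"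
    using s by (intro ball_eball_mono) (simp add: norm_divide)
  then have "eval_fps f holomorphic_on ball 0 (1 / (2 * s))" by (rule holomorphic_on_eval_fps)
  moreover have "bounded (eval_fps f ` ball 0 (1 / (2 * s)))"
    unfolding bounded_iff using bound by (intro exI[of _ "2 * a"]) blast
  ultimately show "in_Ob (1 / (2 * s)) f" using summ by (simp add: in_Ob_def)
qed

lemma power_choose_two_le_powr:
  assumes "Q > 1" "\<alpha> \<ge> 1"
  shows "Q ^ ((n div \<alpha>) choose 2) \<le> Q powr ((real n)\<^sup>2 / (2 * (real \<alpha>)\<^sup>2))"
proof -
  let ?t = "n div \<alpha>"
  have "real ?t \<le> real n / real \<alpha>" by (rule of_nat_div_le_of_nat)
  then have "(real ?t)\<^sup>2 \<le> (real n / real \<alpha>)\<^sup>2" by (intro power_mono) auto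
  moreover have "real (?t choose 2) \<le> (real ?t)\<^sup>2 / 2"
  proof -
    have "2 * (?t choose 2) \<le> ?t * (?t - 1)" unfolding choose_two by simp
    also have "\<dots> \<le> ?t * ?t" by simp
    finally have "real (2 * (?t choose 2)) \<le> real (?t * ?t)" by (rule of_nat_mono)
    then show ?thesis by (simp add: power2_eq_square)
  qed
  ultimately have "real (?t choose 2) \<le> (real n)\<^sup>2 / (2 * (real \<alpha>)\<^sup>2)"
    by (simp add: power_divide)
  then show ?thesis
    using assms by (subst powr_realpow[symmetric]) (auto intro: powr_mono)
qed

section \<open>The Taylor coefficients of the analytic map\<close>
lemma power_series_at_zero_origin:
  fixes F :: "complex \<times> complex \<times> (complex ^ 'n) \<Rightarrow> complex ^ 'n"
  assumes "has_power_series_at F (0, 0, 0) c"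
  shows "\<forall>\<^sub>F (x, e, y) in nhds (0, 0, 0).
    ((\<lambda>(i, j, m). (x ^ i * e ^ j * (\<Prod>k\<in>UNIV. (y $ k) ^ m k)) *s c (i, j, m))
      has_sum F (x, e, y)) UNIV"
  using assms by (simp add: has_power_series_at_def)

lemma power_series_at_origin_value:
  assumes "has_power_series_at F (0, 0, 0) c"
  shows "c (0, 0, \<lambda>_. 0) = F (0, 0, 0)"
proof -
  have "((\<lambda>(i, j, m). ((0::complex) ^ i * 0 ^ j * (\<Prod>k\<in>UNIV. ((0::complex ^ 'a) $ k) ^ m k)) *s c (i, j, m))
      has_sum F (0, 0, 0)) UNIV"
    using eventually_nhds_x_imp_x[OF power_series_at_zero_origin[OF assms]] by simp
  also have "?this \<longleftrightarrow> (c has_sum F (0, 0, 0)) {(0, 0, \<lambda>_. 0)}"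
    by (intro has_sum_cong_neutral) (auto simp: power_0_left fun_eq_iff split: if_splits)
  finally have "(c has_sum F (0, 0, 0)) {(0, 0, \<lambda>_. 0)}" .
  moreover have "(c has_sum c (0, 0, \<lambda>_. 0)) {(0, 0, \<lambda>_. 0)}"
    using has_sum_finite[of "{(0, 0, \<lambda>_. 0)}" c] by simp
  ultimately show ?thesis by (metis has_sum_unique)
qed

text \<open>
  The expansion converges at a point of the diagonal \<open>(\<rho>, \<rho>, (\<rho>, \<dots>, \<rho>))\<close> with \<open>\<rho> > 0\<close>, and
  unconditional convergence in the complex numbers is absolute convergence.
\<close>
lemma power_series_at_origin_coeff_bound:
  fixes F :: "complex \<times> complex \<times> (complex ^ 'n) \<Rightarrow> complex ^ 'n"
  assumes "has_power_series_at F (0, 0, 0) c"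
  obtains \<rho> M :: real where "\<rho> > 0" "M \<ge> 0"
    "\<And>D l. finite D \<Longrightarrow>
      (\<Sum>(i, j, m)\<in>D. cmod (c (i, j, m) $ l) * \<rho> ^ (i + j + (\<Sum>k\<in>UNIV. m k))) \<le> M"
proof -
  let ?p = "\<lambda>t :: real. (complex_of_real t, complex_of_real t, \<chi> k :: 'n. complex_of_real t)"
  let ?P = "\<lambda>(x, e, y). ((\<lambda>(i, j, m). (x ^ i * e ^ j * (\<Prod>k\<in>UNIV. (y $ k) ^ m k)) *s c (i, j, m))
      has_sum F (x, e, y)) UNIV"
  have "(?p \<longlongrightarrow> (0, 0, 0)) (at_right 0)"
    by (intro tendsto_Pair vec_tendstoI) (auto intro!: tendsto_eq_intros)
  from eventually_compose_filterlim[OF power_series_at_zero_origin[OF assms] this]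
  have "\<forall>\<^sub>F t in at_right 0. ?P (?p t)" .
  then have "\<forall>\<^sub>F t in at_right 0. ?P (?p t) \<and> 0 < t"
    by (rule eventually_conj) (rule eventually_at_right_less)
  from eventually_happens'[OF trivial_limit_at_right_real this]
  obtain \<rho> where \<rho>: "0 < \<rho>" "?P (?p \<rho>)" by (elim exE conjE) (rule that)
  define g where "g = (\<lambda>l (i, j, m). cmod (c (i, j, m) $ l) * \<rho> ^ (i + j + (\<Sum>k\<in>UNIV. m k)))"
  have summable: "g l summable_on UNIV" for l
  proof -
    have "((\<lambda>d. (case d of (i, j, m) \<Rightarrow> (complex_of_real \<rho> ^ i * complex_of_real \<rho> ^ j *
        (\<Prod>k\<in>UNIV. complex_of_real \<rho> ^ m k)) *s c (i, j, m)) $ l) has_sum F (?p \<rho>) $ l) UNIV"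
      using has_sum_bounded_linear[OF bounded_linear_vec_nth \<rho>(2)[unfolded prod.case]] by simp
    then have "(\<lambda>d. cmod ((case d of (i, j, m) \<Rightarrow> (complex_of_real \<rho> ^ i * complex_of_real \<rho> ^ j *
        (\<Prod>k\<in>UNIV. complex_of_real \<rho> ^ m k)) *s c (i, j, m)) $ l)) summable_on UNIV"
      by (intro iffD1[OF summable_on_iff_abs_summable_on_complex] has_sum_imp_summable)
    also have "(\<lambda>d. cmod ((case d of (i, j, m) \<Rightarrow> (complex_of_real \<rho> ^ i * complex_of_real \<rho> ^ j *
        (\<Prod>k\<in>UNIV. complex_of_real \<rho> ^ m k)) *s c (i, j, m)) $ l)) = g l"
      using \<rho>(1) by (auto simp: g_def fun_eq_iff norm_mult norm_power power_add power_sum prod_norm[symmetric])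
    finally show ?thesis .
  qed
  have nonneg: "g l d \<ge> 0" for l d using \<rho>(1) by (auto simp: g_def split: prod.split)
  have "sum (g l) D \<le> (\<Sum>l\<in>UNIV. infsum (g l) UNIV)" if "finite D" for D l
  proof -
    have "sum (g l) D \<le> infsum (g l) UNIV"
      by (rule finite_sum_le_infsum[OF summable that]) (auto simp: nonneg)
    also have "\<dots> \<le> (\<Sum>l\<in>UNIV. infsum (g l) UNIV)"
      by (rule member_le_sum) (auto intro: infsum_nonneg nonneg)
    finally show ?thesis .
  qed
  moreover have "(\<Sum>l\<in>UNIV. infsum (g l) UNIV) \<ge> 0"
    by (intro sum_nonneg infsum_nonneg nonneg)
  ultimately show ?thesis using that[OF \<rho>(1), of "\<Sum>l\<in>UNIV. infsum (g l) UNIV"]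
    by (simp add: g_def)
qed

text \<open>
  On the \<open>l\<close>-th coordinate axis of \<open>y\<close> only the monomials \<open>y\<^sub>l\<^sup>p\<close> survive, so that the expansion of \<open>F\<close>
  becomes a power series in one variable, whose first coefficient is the derivative.
\<close>
lemma jacobian_eq_linear_part:
  fixes F :: "complex \<times> complex \<times> (complex ^ 'n) \<Rightarrow> complex ^ 'n"
  assumes "has_power_series_at F (0, 0, 0) c"
  shows "jacobian_y0 F = linear_part c"
proof -
  have "deriv (\<lambda>t. F (0, 0, axis l t) $ k) 0 = c (linear_index l) $ k" for k l
  proof -
    define h where "h = (\<lambda>p :: nat. (0 :: nat, 0 :: nat, \<lambda>k :: 'n. if k = l then p else 0))"
    define f where "f = Abs_fps (\<lambda>p. c (h p) $ k)"
    have "inj h" by (auto simp: inj_def h_def fun_eq_iff split: if_splits)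
    have sums: "(\<lambda>p. fps_nth f p * t ^ p) sums (F (0, 0, axis l t) $ k)"
      if "((\<lambda>(i, j, m). ((0::complex) ^ i * 0 ^ j * (\<Prod>k\<in>UNIV. (axis l t $ k) ^ m k)) *s c (i, j, m))
        has_sum F (0, 0, axis l t)) UNIV" for t
    proof -
      let ?g = "\<lambda>(i, j, m). ((0::complex) ^ i * 0 ^ j * (\<Prod>k\<in>UNIV. (axis l t $ k) ^ m k)) *s c (i, j, m)"
      have "?g d = 0" if "d \<notin> range h" for d
      proof -
        obtain i j m where d: "d = (i, j, m)" by (cases d)
        show ?thesis
        proof (cases "i = 0 \<and> j = 0")
          case True
          then have "m \<noteq> (\<lambda>k. if k = l then m l else 0)" using that by (auto simp: d h_def)
          then obtain k' where "k' \<noteq> l" "m k' \<noteq> 0" by (auto simp: fun_eq_iff split: if_splits)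
          then have "(\<Prod>k\<in>UNIV. (axis l t $ k) ^ m k) = 0"
            by (intro prod_zero bexI[of _ k']) (auto simp: axis_def)
          then show ?thesis by (simp add: d)
        qed (auto simp: d)
      qed
      then have "(?g has_sum F (0, 0, axis l t)) (range h)"
        using has_sum_cong_neutral[of "range h" UNIV ?g ?g] that by auto
      then have "((?g \<circ> h) has_sum F (0, 0, axis l t)) UNIV"
        using has_sum_reindex[OF \<open>inj h\<close>] by blast
      then have "((\<lambda>p. (?g \<circ> h) p $ k) has_sum F (0, 0, axis l t) $ k) UNIV"
        by (rule has_sum_bounded_linear[OF bounded_linear_vec_nth])
      moreover have "(?g \<circ> h) p $ k = fps_nth f p * t ^ p" for p
      proof -
        have "(\<Prod>k\<in>UNIV. (axis l t $ k) ^ (if k = l then p else 0)) = (\<Prod>k\<in>UNIV. if k = l then t ^ p else 1)"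
          by (intro prod.cong) (auto simp: axis_def)
        then show ?thesis by (simp add: h_def f_def)
      qed
      ultimately show ?thesis by (simp add: has_sum_imp_sums)
    qed
    have "((\<lambda>t :: complex. (0 :: complex, 0 :: complex, axis l t :: complex ^ 'n)) \<longlongrightarrow> (0, 0, 0)) (nhds 0)"
      by (intro tendsto_Pair vec_tendstoI tendsto_const) (auto simp: axis_def tendsto_def intro: eventually_nhds_in_open)
    from eventually_compose_filterlim[OF power_series_at_zero_origin[OF assms] this]
    have ev: "\<forall>\<^sub>F t in nhds 0. (\<lambda>p. fps_nth f p * t ^ p) sums (F (0, 0, axis l t) $ k)"
      by (rule eventually_mono) (use sums in auto)
    have "fps_conv_radius f > 0"
    proof -
      obtain r where r: "r > 0" "\<And>t. dist t 0 < r \<Longrightarrow> (\<lambda>p. fps_nth f p * t ^ p) sums (F (0, 0, axis l t) $ k)"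
        using ev unfolding eventually_nhds_metric by blast
      have "conv_radius (fps_nth f) \<ge> norm (complex_of_real (r / 2))"
        using r(2)[of "complex_of_real (r / 2)"] r(1) by (intro conv_radius_geI) (auto simp: sums_iff)
      then show ?thesis using r(1) by (auto simp: fps_conv_radius_def intro: less_le_trans[rotated])
    qed
    moreover have "\<forall>\<^sub>F t in nhds 0. eval_fps f t = F (0, 0, axis l t) $ k"
      using ev by eventually_elim (simp add: eval_fps_def sums_iff)
    ultimately have "(\<lambda>t. F (0, 0, axis l t) $ k) has_fps_expansion f"
      by (simp add: has_fps_expansion_def)
    from has_fps_expansion_deriv[OF this]
    have "deriv (\<lambda>t. F (0, 0, axis l t) $ k) 0 = fps_nth (fps_deriv f) 0"
      unfolding has_fps_expansion_def using eventually_nhds_x_imp_x by (fastforce simp: eval_fps_at_0)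
    also have "\<dots> = c (h 1) $ k" by (simp add: f_def)
    also have "h 1 = linear_index l" by (auto simp: h_def linear_index_def of_bool_def)
    finally show ?thesis .
  qed
  then show ?thesis by (simp add: jacobian_y0_def linear_part_def vec_eq_iff)
qed

section \<open>The formal solution and its \<open>q\<close>-Gevrey bounds\<close>
theorem theorem1p2:
  fixes q :: complex and \<alpha> :: nat
    and F :: "complex \<times> complex \<times> (complex ^ 'n) \<Rightarrow> complex ^ 'n"
  assumes "cmod q > 1" and "\<alpha> \<ge> 1"
    and "analytic_near F (0, 0, 0)"
    and "F (0, 0, 0) = 0"
    and "invertible (jacobian_y0 F)"
  shows "(\<exists>!y. formal_solution q \<alpha> F y) \<and>
    (\<forall>y. formal_solution q \<alpha> F y \<longrightarrow>
      (\<exists>r>0.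
        (\<forall>n k. in_Ob (r / cmod q ^ (n div \<alpha>)) (fps_nth (y $ k) n)) \<and>
        (\<exists>C>0. \<exists>A>0. \<forall>n.
          (SUP x\<in>ball 0 (r / cmod q ^ (n div \<alpha>)). max_norm (eps_coeff_at y n x))
            \<le> C * A ^ n * cmod q powr ((real n)\<^sup>2 / (2 * (real \<alpha>)\<^sup>2)))))"
proof -
  define c where "c = taylor_coeff F"
  have "\<exists>c. has_power_series_at F (0, 0, 0) c"
    using assms(3) by (auto simp: analytic_near_def)
  then have series: "has_power_series_at F (0, 0, 0) c"
    unfolding c_def taylor_coeff_def by (rule someI_ex)
  have c0: "c (0, 0, \<lambda>_. 0) = 0"
    using power_series_at_origin_value[OF series] assms(4) by simp
  obtain B where B: "linear_part c ** B = mat 1" "B ** linear_part c = mat 1"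
    using assms(5) unfolding jacobian_eq_linear_part[OF series] invertible_def by blast
  define Y where "Y = limit_solution q \<alpha> c B"
  have solution_iff: "formal_solution q \<alpha> F y \<longleftrightarrow> y = Y" for y
  proof -
    have "formal_solution q \<alpha> F y \<longleftrightarrow> zero_const_term y \<and> solution_operator q \<alpha> c B y = y"
      unfolding formal_solution_def c_def[symmetric]
      using solution_iff_fixed_point[where q = q and \<alpha> = \<alpha>, OF _ B] by (auto simp: eq_commute[of y])
    also have "\<dots> \<longleftrightarrow> y = Y"
      unfolding Y_def using limit_solution_fixed_point[where q = q and c = c and B = B, OF assms(2) c0]
        fixed_point_unique[where q = q and c = c and B = B, OF assms(2)] by auto
    finally show ?thesis .
  qed
  obtain \<rho> M where \<rho>: "\<rho> > 0" and M: "M \<ge> 0"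
    and c_bound: "\<And>D l. finite D \<Longrightarrow>
      (\<Sum>(i, j, m)\<in>D. cmod (c (i, j, m) $ l) * \<rho> ^ (i + j + (\<Sum>k\<in>UNIV. m k))) \<le> M"
    using power_series_at_origin_coeff_bound[OF series] by blast
  define K where "K = (\<Sum>l\<in>UNIV. \<Sum>k\<in>UNIV. cmod (B $ l $ k))"
  have B_bound: "(\<Sum>k\<in>UNIV. cmod (B $ l $ k)) \<le> K" for l
    unfolding K_def by (rule member_le_sum) (auto intro: sum_nonneg)
  have K: "K \<ge> 0" by (auto simp: K_def intro!: sum_nonneg)
  obtain \<delta> \<eta> where \<delta>: "0 < \<delta>" "\<delta> \<le> \<rho>" and \<eta>: "0 < \<eta>" "\<eta> \<le> \<rho>" "\<eta> \<le> 1"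
    and small: "K * (2 * cmod q / cmod (q - 1) * \<eta> * \<delta> + M * (\<eta> / \<rho> + (\<delta> / \<rho>) ^ 2)) \<le> \<delta>"
    by (rule small_parameters[OF \<rho> K _ M, of "2 * cmod q / cmod (q - 1)"]) auto
  define r where "r = \<eta> / 2"
  define a where "a = (\<lambda>n. \<delta> * cmod q ^ ((n div \<alpha>) choose 2) * (1 / \<eta> ^ 2) ^ n)"
  have coeff: "cmod (coeff2 (Y $ l) n k) \<le> a n * (cmod q ^ (n div \<alpha>) / \<eta>) ^ k" for l n k
    unfolding Y_def a_def using assms(1) \<eta>(1)
      truncated_norm_iterate[OF assms(1,2) c0 c_bound B_bound \<delta> \<eta> small]
    by (intro limit_solution_coeff_bound) auto
  have radius: "1 / (2 * (cmod q ^ (n div \<alpha>) / \<eta>)) = r / cmod q ^ (n div \<alpha>)" for n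
    using \<eta>(1) by (simp add: r_def)
  have pos: "cmod q ^ (n div \<alpha>) / \<eta> > 0" for n
    using assms(1) \<eta>(1) by (intro divide_pos_pos zero_less_power) auto
  have r: "r > 0" using \<eta>(1) by (simp add: r_def)
  have bounded: "in_Ob (r / cmod q ^ (n div \<alpha>)) (fps_nth (Y $ l) n)" for n l
    using geometric_coeffs_imp_bounded(1)[OF coeff pos] unfolding radius .
  have sup: "(SUP x\<in>ball 0 (r / cmod q ^ (n div \<alpha>)). max_norm (eps_coeff_at Y n x))
      \<le> 2 * \<delta> * (1 / \<eta> ^ 2) ^ n * cmod q powr ((real n)\<^sup>2 / (2 * (real \<alpha>)\<^sup>2))" for n
  proof (rule cSUP_least)
    have "r / cmod q ^ (n div \<alpha>) > 0"
      using r assms(1) by (intro divide_pos_pos zero_less_power) auto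
    then show "ball (0 :: complex) (r / cmod q ^ (n div \<alpha>)) \<noteq> {}" by simp
    fix x :: complex assume x: "x \<in> ball 0 (r / cmod q ^ (n div \<alpha>))"
    have "max_norm (eps_coeff_at Y n x) \<le> 2 * a n"
      using geometric_coeffs_imp_bounded(2)[OF coeff pos] x unfolding radius
      by (auto simp: max_norm_def eps_coeff_at_def)
    also have "\<dots> = 2 * \<delta> * (1 / \<eta> ^ 2) ^ n * cmod q ^ ((n div \<alpha>) choose 2)"
      by (simp add: a_def)
    also have "\<dots> \<le> 2 * \<delta> * (1 / \<eta> ^ 2) ^ n * cmod q powr ((real n)\<^sup>2 / (2 * (real \<alpha>)\<^sup>2))"
      using \<delta>(1) by (intro mult_left_mono power_choose_two_le_powr assms(1,2)) auto
    finally show "max_norm (eps_coeff_at Y n x)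
      \<le> 2 * \<delta> * (1 / \<eta> ^ 2) ^ n * cmod q powr ((real n)\<^sup>2 / (2 * (real \<alpha>)\<^sup>2))" .
  qed
  \<comment> \<open>\<open>A = \<eta>\<^bsup>-2\<^esup>\<close> because each factor \<open>\<epsilon>\<close> has weight two, and \<open>C = 2\<delta>\<close> from the geometric series.\<close>
  have "\<exists>C>0. \<exists>A>0. \<forall>n. (SUP x\<in>ball 0 (r / cmod q ^ (n div \<alpha>)). max_norm (eps_coeff_at Y n x))
      \<le> C * A ^ n * cmod q powr ((real n)\<^sup>2 / (2 * (real \<alpha>)\<^sup>2))"
    using sup \<delta>(1) \<eta>(1) by (intro exI[of _ "2 * \<delta>"] conjI exI[of _ "1 / \<eta> ^ 2"] allI) simp_all
  then show ?thesis using r bounded unfolding solution_iff by blast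
qed

end
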